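(* Let $n,m\ge 1$ be integers, let $f,g_1,\dots,g_m\in\mathbb{R}[\bar z,z]$ be real-valued complex polynomials on $\mathbb{C}^n$, and let $K=\{z\in\mathbb{C}^n : g_i(z)\ge 0,\ i=1,\dots,m\}$. Assume that one of the constraints defining $K$ is a sphere constraint $|z_1|^2+\dots+|z_n|^2=R^2$ for some $R>0$ (that is, both $R^2-\sum_{j}|z_j|^2$ and its opposite occur among $g_1,\dots,g_m$). Let $f^{\mathrm{opt}}:=\inf_{z\in K}f(z)$ and let $\rho_d,\rho_d^*$ be the optimal values of the complex moment and complex sum-of-squares relaxations of order $d\geq d^{\min}$ defined in the context. Then $\rho_d^*\to f^{\mathrm{opt}}$ and $\rho_d\to f^{\mathrm{opt}}$ as $d\to+\infty$.
   Context: Notation. For $z\in\mathbb{C}^n$, $\alpha\in\mathbb{N}^n$: $z^\alpha=z_1^{\alpha_1}\cdots z_n^{\alpha_n}$, $|\alpha|=\alpha_1+\dots+\alpha_n$, $\bar z$ is the componentwise conjugate. $\mathbb{C}_d[z]$ is the set of holomorphic polynomials $\sum_{|\alpha|\le d}p_\alpha z^\alpha$ ($p_\alpha\in\mathbb{C}$). $\mathbb{R}_d[\bar z,z]$ is the set of functions $\sum_{|\alpha|,|\beta|\le d}\varphi_{\alpha,\beta}\bar z^\alpha z^\beta$ ($\varphi_{\alpha,\beta}\in\mathbb{C}$) that are real-valued on $\mathbb{C}^n$, and $\mathbb{R}[\bar z,z]=\bigcup_d\mathbb{R}_d[\bar z,z]$. $\Sigma_d[z]$ is the set of finite sums $\sum_{j=1}^r|p_j|^2$,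 $r\ge1$, with $p_j\in\mathbb{C}_d[z]$. Degrees. $f\in\mathbb{R}_k[\bar z,z]$, $g_i\in\mathbb{R}_{k_i}[\bar z,z]$, where there exist $|\alpha|=k$, $|\beta|\le k$ with $f_{\alpha,\beta}\ne0$, and $|\alpha|=k_i$, $|\beta|\le k_i$ with $g_{i,\alpha,\beta}\neq0$. Put $g_0:=1$, $k_0:=0$, $d^{\min}:=\max\{k,k_1,\dots,k_m\}$. $f^{\mathrm{opt}}:=+\infty$ if $K=\emptyset$. Moments. $\mathcal{H}_d$ is the set of complex families $y=(y_{\alpha,\beta})_{|\alpha|,|\beta|\le d}$ with $\overline{y_{\alpha,\beta}}=y_{\beta,\alpha}$. $L_y$ is the linear functional with $L_y(\bar z^\alpha z^\beta)=y_{\alpha,\beta}$. For $\varphi=\sum\varphi_{\gamma,\delta}\bar z^\gamma z^\delta$, $M_d(\varphi y)$ is the matrix indexed by $|\alpha|,|\beta|\le d$ with entries $M_d(\varphi y)(\alpha,\beta)=\sum_{\gamma,\delta}\varphi_{\gamma,\delta}\,y_{\alpha+\gamma,\beta+\delta}$. Relaxations. For $d\ge d^{\min}$, $$\rho_d:=\inf_{y\in\mathcal{H}_d}L_y(f)\ \text{ s.t. } y_{0,0}=1,\ M_{d-k_i}(g_iy)\succcurlyeq0,\ i=0,\dots,m,$$ $$\rho_d^*:=\sup\Big\{\lambda\in\mathbb{R} : f-\lambda=\sum_{i=0}^m\sigma_ig_i,\ \sigma_i\in\Sigma_{d-k_i}[z]\Big\}.$$ An infimum over the empty set is $+\infty$,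 a supremum over the empty set is $-\infty$. *)

theory Defs
  imports "HOL-Analysis.Analysis" "HOL-Library.Poly_Mapping"
begin

section \<open>Polynomials in a complex vector and its conjugate\<close>

text \<open>The coefficient of \<open>\<phi>\<close> at \<open>(\<alpha>, \<beta>)\<close> belongs to the monomial
  \<open>(cnj z)\<^sup>\<alpha> z\<^sup>\<beta>\<close>. By \<open>cpoly_eqI\<close> below, the coefficients are determined by the
  function \<open>ceval \<phi>\<close>, so polynomials and polynomial functions may be identified.\<close>

type_synonym 'n cpoly = "((nat ^ 'n) \<times> (nat ^ 'n), complex) poly_mapping"

definition mdeg :: "nat ^ 'n::finite \<Rightarrow> nat" where
  "mdeg \<alpha> = (\<Sum>j\<in>UNIV. \<alpha> $ j)"

definition zpow :: "complex ^ 'n::finite \<Rightarrow> nat ^ 'n \<Rightarrow> complex" where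
  "zpow z \<alpha> = (\<Prod>j\<in>UNIV. (z $ j) ^ (\<alpha> $ j))"

definition ceval :: "'n::finite cpoly \<Rightarrow> complex ^ 'n \<Rightarrow> complex" where
  "ceval \<phi> z = (\<Sum>(\<alpha>, \<beta>)\<in>Poly_Mapping.keys \<phi>.
     Poly_Mapping.lookup \<phi> (\<alpha>, \<beta>) * cnj (zpow z \<alpha>) * zpow z \<beta>)"

definition real_polys_le :: "nat \<Rightarrow> 'n::finite cpoly set" where
  "real_polys_le d = {\<phi>. (\<forall>(\<alpha>, \<beta>)\<in>Poly_Mapping.keys \<phi>. mdeg \<alpha> \<le> d \<and> mdeg \<beta> \<le> d)
     \<and> (\<forall>z. ceval \<phi> z \<in> \<real>)}"

definition real_polys :: "'n::finite cpoly set" where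
  "real_polys = (\<Union>d. real_polys_le d)"

definition reval :: "'n::finite cpoly \<Rightarrow> complex ^ 'n \<Rightarrow> real" where
  "reval \<phi> z = Re (ceval \<phi> z)"

text \<open>The degree \<open>k\<close> of \<open>\<phi>\<close>. For \<open>\<phi> \<noteq> 0\<close> it is the \<open>k\<close> with \<open>\<phi> \<in> real_polys_le k\<close> such that
  \<open>\<phi>\<close> has a nonzero coefficient with \<open>mdeg \<alpha> = k\<close> and \<open>mdeg \<beta> \<le> k\<close>, see \<open>cdegree_unique\<close> and
  \<open>cdegree_attained\<close>; the zero polynomial has degree 0.\<close>

definition cdegree :: "'n::finite cpoly \<Rightarrow> nat" where
  "cdegree \<phi> = (LEAST k. \<phi> \<in> real_polys_le k)"

definition holomorphic_polys_le :: "nat \<Rightarrow> (complex ^ 'n::finite \<Rightarrow> complex) set" where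
  "holomorphic_polys_le d = {p. \<exists>c. p = (\<lambda>z. \<Sum>\<alpha> | mdeg \<alpha> \<le> d. c \<alpha> * zpow z \<alpha>)}"

definition herm_sos :: "nat \<Rightarrow> (complex ^ 'n::finite \<Rightarrow> real) set" where
  "herm_sos d = {\<sigma>. \<exists>r p. r \<ge> 1 \<and> (\<forall>j\<in>{1..r::nat}. p j \<in> holomorphic_polys_le d)
     \<and> \<sigma> = (\<lambda>z. \<Sum>j=1..r. (cmod (p j z))\<^sup>2)}"

section \<open>Moment matrices\<close>

text \<open>A family indexed by \<open>|\<alpha>|, |\<beta>| \<le> d\<close> is a function that vanishes at all other indices.\<close>

definition herm_families :: "nat \<Rightarrow> (nat ^ 'n::finite \<Rightarrow> nat ^ 'n \<Rightarrow> complex) set" where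
  "herm_families d = {y. (\<forall>\<alpha> \<beta>. cnj (y \<alpha> \<beta>) = y \<beta> \<alpha>)
     \<and> (\<forall>\<alpha> \<beta>. \<not> (mdeg \<alpha> \<le> d \<and> mdeg \<beta> \<le> d) \<longrightarrow> y \<alpha> \<beta> = 0)}"

definition riesz :: "(nat ^ 'n::finite \<Rightarrow> nat ^ 'n \<Rightarrow> complex) \<Rightarrow> 'n cpoly \<Rightarrow> complex" where
  "riesz y \<phi> = (\<Sum>(\<alpha>, \<beta>)\<in>Poly_Mapping.keys \<phi>. Poly_Mapping.lookup \<phi> (\<alpha>, \<beta>) * y \<alpha> \<beta>)"

definition loc_matrix ::
  "'n::finite cpoly \<Rightarrow> (nat ^ 'n \<Rightarrow> nat ^ 'n \<Rightarrow> complex) \<Rightarrow> nat ^ 'n \<Rightarrow> nat ^ 'n \<Rightarrow> complex" where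
  "loc_matrix \<phi> y \<alpha> \<beta> = (\<Sum>(\<gamma>, \<delta>)\<in>Poly_Mapping.keys \<phi>.
     Poly_Mapping.lookup \<phi> (\<gamma>, \<delta>) * y (\<alpha> + \<gamma>) (\<beta> + \<delta>))"

definition psd_on :: "'i set \<Rightarrow> ('i \<Rightarrow> 'i \<Rightarrow> complex) \<Rightarrow> bool" where
  "psd_on I M \<longleftrightarrow> (\<forall>a\<in>I. \<forall>b\<in>I. cnj (M a b) = M b a)
     \<and> (\<forall>v. 0 \<le> Re (\<Sum>a\<in>I. \<Sum>b\<in>I. cnj (v a) * M a b * v b))"

section \<open>The polynomial optimization problem and its relaxations\<close>

text \<open>The constraints are \<open>g 1, \<dots>, g m\<close>; the value \<open>g 0\<close> is ignored and replaced by the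
  constant polynomial \<open>1\<close>.\<close>

definition with_one :: "(nat \<Rightarrow> 'n::finite cpoly) \<Rightarrow> nat \<Rightarrow> 'n cpoly" where
  "with_one g i = (if i = 0 then 1 else g i)"

definition feasible_set :: "(nat \<Rightarrow> 'n::finite cpoly) \<Rightarrow> nat \<Rightarrow> (complex ^ 'n) set" where
  "feasible_set g m = {z. \<forall>i\<in>{1..m}. reval (g i) z \<ge> 0}"

definition f_opt :: "'n::finite cpoly \<Rightarrow> (nat \<Rightarrow> 'n cpoly) \<Rightarrow> nat \<Rightarrow> ereal" where
  "f_opt f g m = (INF z\<in>feasible_set g m. ereal (reval f z))"

definition d_min :: "'n::finite cpoly \<Rightarrow> (nat \<Rightarrow> 'n cpoly) \<Rightarrow> nat \<Rightarrow> nat" where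
  "d_min f g m = Max (insert (cdegree f) ((\<lambda>i. cdegree (g i)) ` {1..m}))"

text \<open>Both relaxations are meaningful for \<open>d \<ge> d_min f g m\<close> only. In that range the subtractions
  below are not truncated. The number \<open>riesz y f\<close> is real, see \<open>riesz_real\<close>.\<close>

definition moment_value :: "'n::finite cpoly \<Rightarrow> (nat \<Rightarrow> 'n cpoly) \<Rightarrow> nat \<Rightarrow> nat \<Rightarrow> ereal" where
  "moment_value f g m d = Inf {ereal (Re (riesz y f)) | y. y \<in> herm_families d \<and> y 0 0 = 1 \<and>
     (\<forall>i\<in>{0..m}. psd_on {\<alpha>. mdeg \<alpha> \<le> d - cdegree (with_one g i)}
        (loc_matrix (with_one g i) y))}"

definition sos_value :: "'n::finite cpoly \<Rightarrow> (nat \<Rightarrow> 'n cpoly) \<Rightarrow> nat \<Rightarrow> nat \<Rightarrow> ereal" where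
  "sos_value f g m d = Sup {ereal l | l. \<exists>\<sigma>.
     (\<forall>i\<in>{0..m}. \<sigma> i \<in> herm_sos (d - cdegree (with_one g i))) \<and>
     (\<forall>z. reval f z - l = (\<Sum>i=0..m. \<sigma> i z * reval (with_one g i) z))}"

section \<open>Well-definedness\<close>

lemma finite_mdeg_le: "finite {\<alpha> :: nat ^ 'n::finite. mdeg \<alpha> \<le> d}"
proof -
  have "{\<alpha> :: nat ^ 'n. mdeg \<alpha> \<le> d} \<subseteq> vec_lambda ` (UNIV \<rightarrow>\<^sub>E {..d})"
  proof
    fix \<alpha> :: "nat ^ 'n" assume a: "\<alpha> \<in> {\<alpha>. mdeg \<alpha> \<le> d}"
    have "\<alpha> $ j \<le> d" for j
    proof -
      have "\<alpha> $ j \<le> (\<Sum>j\<in>UNIV. \<alpha> $ j)" by (rule member_le_sum) auto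
      with a show ?thesis by (simp add: mdeg_def)
    qed
    then have "vec_nth \<alpha> \<in> UNIV \<rightarrow>\<^sub>E {..d}" by auto
    then show "\<alpha> \<in> vec_lambda ` (UNIV \<rightarrow>\<^sub>E {..d})" by (metis image_eqI vec_nth_inverse)
  qed
  then show ?thesis by (rule finite_subset) (simp add: finite_PiE)
qed

definition mono_fun :: "(nat ^ 'n::finite) \<times> (nat ^ 'n) \<Rightarrow> complex ^ 'n \<Rightarrow> complex" where
  "mono_fun p z = cnj (zpow z (fst p)) * zpow z (snd p)"

lemma mono_fun_mult: "mono_fun p (\<chi> j. w $ j * z $ j) = mono_fun p w * mono_fun p z"
  by (simp add: mono_fun_def zpow_def power_mult_distrib prod.distrib)

lemma mono_fun_one: "mono_fun p (\<chi> j. 1) = 1"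
  by (simp add: mono_fun_def zpow_def)

lemma zpow_axis:
  "zpow (\<chi> i. if i = j then t else 1) \<alpha> = t ^ (\<alpha> $ (j :: 'n::finite))"
proof -
  have "zpow (\<chi> i. if i = j then t else 1) \<alpha> = (\<Prod>i\<in>UNIV. if i = j then t ^ (\<alpha> $ i) else 1)"
    unfolding zpow_def by (rule prod.cong) auto
  also have "\<dots> = t ^ (\<alpha> $ j)" by (simp add: prod.delta)
  finally show ?thesis .
qed

lemma powers_eq:
  assumes "\<And>t. cnj t ^ a * t ^ b = cnj t ^ c * t ^ (d :: nat)"
  shows "a = c \<and> b = d"
proof -
  have s: "a + b = c + d"
  proof -
    have "(2 :: complex) ^ (a + b) = 2 ^ (c + d)"
      using assms[of 2] by (simp add: power_add)
    then have "cmod (2 ^ (a + b)) = cmod (2 ^ (c + d))" by (rule arg_cong)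
    then show ?thesis by (simp only: norm_power norm_numeral) simp
  qed
  define q where "q = real b + real c - real a - real d"
  define x where "x = 1 / (1 + \<bar>q\<bar>)"
  have e: "cnj (cis x) ^ k = cis (- (real k * x))" for k
    by (simp add: cis_cnj Complex.DeMoivre)
  have "cis (- (real a * x)) * cis (real b * x) = cis (- (real c * x)) * cis (real d * x)"
    using assms[of "cis x"] by (simp only: e Complex.DeMoivre)
  then have "cis (real b * x - real a * x) = cis (real d * x - real c * x)"
    by (simp add: cis_mult algebra_simps)
  then have "cis ((real b * x - real a * x) - (real d * x - real c * x)) = 1"
    by (simp flip: cis_divide)
  then have "cis (q * x) = 1" by (simp add: q_def algebra_simps)
  then have "cos (q * x) = 1" by (simp add: complex_eq_iff)
  then obtain n :: int where n: "q * x = of_int n * 2 * pi" by (auto simp: cos_one_2pi_int)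
  have "\<bar>q * x\<bar> < 1" by (simp add: x_def abs_mult divide_simps)
  moreover have "\<bar>of_int n * 2 * pi\<bar> \<ge> 1" if "n \<noteq> 0"
  proof -
    have "\<bar>of_int n :: real\<bar> \<ge> 1" using that by linarith
    moreover have "2 * pi \<ge> 1" using pi_gt3 by simp
    ultimately have "1 * 1 \<le> \<bar>of_int n :: real\<bar> * (2 * pi)" by (intro mult_mono) auto
    then show ?thesis by (simp add: abs_mult)
  qed
  ultimately have "n = 0" using n by fastforce
  then have "q * x = 0" using n by simp
  moreover have "x > 0" by (simp add: x_def add_pos_nonneg)
  ultimately have "q = 0" by simp
  with s show ?thesis unfolding q_def by linarith
qed

lemma mono_fun_inj:
  fixes p q :: "(nat ^ 'n::finite) \<times> (nat ^ 'n)"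
  assumes "mono_fun p = mono_fun q"
  shows "p = q"
proof -
  have "fst p $ j = fst q $ j \<and> snd p $ j = snd q $ j" for j
  proof (rule powers_eq)
    fix t
    show "cnj t ^ (fst p $ j) * t ^ (snd p $ j) = cnj t ^ (fst q $ j) * t ^ (snd q $ j)"
      using fun_cong[OF assms, of "\<chi> i. if i = j then t else 1"]
      by (simp add: mono_fun_def zpow_axis)
  qed
  then show ?thesis by (simp add: prod_eq_iff vec_eq_iff)
qed

lemma mono_fun_independent:
  fixes S :: "((nat ^ 'n::finite) \<times> (nat ^ 'n)) set"
  assumes "finite S" "\<And>z. (\<Sum>p\<in>S. c p * mono_fun p z) = 0"
  shows "\<forall>p\<in>S. c p = 0"
  using assms
proof (induction S arbitrary: c rule: finite_induct)
  case empty
  then show ?case by simp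
next
  case (insert p S)
  have "\<forall>q\<in>S. c q * (mono_fun q w - mono_fun p w) = 0" for w
  proof (rule insert.IH)
    fix z
    have "(\<Sum>q\<in>insert p S. c q * mono_fun q (\<chi> j. w $ j * z $ j)) = 0"
      and "mono_fun p w * (\<Sum>q\<in>insert p S. c q * mono_fun q z) = 0"
      using insert.prems by (simp_all del: sum.insert)
    then have "0 = (\<Sum>q\<in>insert p S. c q * mono_fun q (\<chi> j. w $ j * z $ j))
        - mono_fun p w * (\<Sum>q\<in>insert p S. c q * mono_fun q z)"
      by (simp del: sum.insert)
    also have "\<dots> = (\<Sum>q\<in>insert p S. c q * (mono_fun q w - mono_fun p w) * mono_fun q z)"
      unfolding mono_fun_mult sum_distrib_left sum_subtractf[symmetric]
      by (rule sum.cong) (simp_all add: algebra_simps)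
    also have "\<dots> = (\<Sum>q\<in>S. c q * (mono_fun q w - mono_fun p w) * mono_fun q z)"
      using insert.hyps by simp
    finally show "(\<Sum>q\<in>S. c q * (mono_fun q w - mono_fun p w) * mono_fun q z) = 0" by simp
  qed
  moreover have "\<exists>w. mono_fun q w \<noteq> mono_fun p w" if "q \<in> S" for q
    using that insert.hyps mono_fun_inj by blast
  ultimately have 0: "\<forall>q\<in>S. c q = 0" by (metis eq_iff_diff_eq_0 mult_eq_0_iff)
  then have "c p * mono_fun p (\<chi> j. 1) = 0"
    using insert.prems[of "\<chi> j. 1"] insert.hyps by simp
  then show ?case using 0 by (simp add: mono_fun_one)
qed

lemma ceval_superset:
  assumes "finite S" "Poly_Mapping.keys \<phi> \<subseteq> S"
  shows "ceval \<phi> z = (\<Sum>p\<in>S. Poly_Mapping.lookup \<phi> p * mono_fun p z)"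
proof -
  have "ceval \<phi> z = (\<Sum>p\<in>Poly_Mapping.keys \<phi>. Poly_Mapping.lookup \<phi> p * mono_fun p z)"
    unfolding ceval_def mono_fun_def by (rule sum.cong) (auto simp: mult.assoc)
  also have "\<dots> = (\<Sum>p\<in>S. Poly_Mapping.lookup \<phi> p * mono_fun p z)"
    by (rule sum.mono_neutral_left) (use assms in \<open>auto simp: in_keys_iff\<close>)
  finally show ?thesis .
qed

lemma cpoly_eqI:
  fixes \<phi> \<psi> :: "'n::finite cpoly"
  assumes "ceval \<phi> = ceval \<psi>"
  shows "\<phi> = \<psi>"
proof (rule poly_mapping_eqI)
  let ?S = "Poly_Mapping.keys \<phi> \<union> Poly_Mapping.keys \<psi>"
  fix p
  have "\<forall>p\<in>?S. Poly_Mapping.lookup \<phi> p - Poly_Mapping.lookup \<psi> p = 0"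
  proof (rule mono_fun_independent)
    fix z
    show "(\<Sum>p\<in>?S. (Poly_Mapping.lookup \<phi> p - Poly_Mapping.lookup \<psi> p) * mono_fun p z) = 0"
      using fun_cong[OF assms, of z] ceval_superset[of ?S \<phi> z] ceval_superset[of ?S \<psi> z]
      by (simp add: left_diff_distrib sum_subtractf)
  qed simp
  then show "Poly_Mapping.lookup \<phi> p = Poly_Mapping.lookup \<psi> p"
    by (cases "p \<in> ?S") (simp, simp only: in_keys_iff Un_iff, simp)
qed

lemma real_coeffs_hermitian:
  fixes \<phi> :: "'n::finite cpoly"
  assumes "\<And>z. ceval \<phi> z \<in> \<real>"
  shows "cnj (Poly_Mapping.lookup \<phi> (\<alpha>, \<beta>)) = Poly_Mapping.lookup \<phi> (\<beta>, \<alpha>)"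
proof -
  let ?c = "Poly_Mapping.lookup \<phi>"
  let ?S = "Poly_Mapping.keys \<phi> \<union> prod.swap ` Poly_Mapping.keys \<phi>"
  have "\<forall>p\<in>?S. cnj (?c (prod.swap p)) - ?c p = 0"
  proof (rule mono_fun_independent)
    fix z
    have "(\<Sum>p\<in>?S. cnj (?c (prod.swap p)) * mono_fun p z)
        = (\<Sum>p\<in>?S. cnj (?c p) * cnj (mono_fun p z))"
      by (rule sum.reindex_bij_witness[of _ prod.swap prod.swap])
        (auto simp: mono_fun_def mult.commute)
    also have "\<dots> = cnj (ceval \<phi> z)" by (simp add: ceval_superset[of ?S])
    also have "\<dots> = ceval \<phi> z" using assms[of z] by (simp add: Reals_cnj_iff)
    finally show "(\<Sum>p\<in>?S. (cnj (?c (prod.swap p)) - ?c p) * mono_fun p z) = 0"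
      by (simp add: left_diff_distrib sum_subtractf ceval_superset[of ?S \<phi> z])
  qed simp
  from bspec[OF this, of "(\<beta>, \<alpha>)"]
  have 1: "cnj (?c (\<alpha>, \<beta>)) = ?c (\<beta>, \<alpha>)" if "(\<beta>, \<alpha>) \<in> ?S"
    using that by simp
  have "?c (\<beta>, \<alpha>) = 0 \<and> ?c (\<alpha>, \<beta>) = 0" if "(\<beta>, \<alpha>) \<notin> ?S"
  proof -
    have "(\<beta>, \<alpha>) \<in> prod.swap ` Poly_Mapping.keys \<phi>" if "(\<alpha>, \<beta>) \<in> Poly_Mapping.keys \<phi>"
      using imageI[OF that, of prod.swap] by simp
    then show ?thesis using that by (auto simp only: in_keys_iff Un_iff)
  qed
  with 1 show ?thesis by (metis complex_cnj_zero)
qed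

lemma cdegree_mem:
  assumes "\<phi> \<in> real_polys"
  shows "\<phi> \<in> real_polys_le (cdegree \<phi>)"
  using assms unfolding real_polys_def cdegree_def by (auto intro: LeastI)

lemma cdegree_unique:
  assumes "\<phi> \<in> real_polys_le k" "mdeg \<alpha> = k" "Poly_Mapping.lookup \<phi> (\<alpha>, \<beta>) \<noteq> 0"
  shows "cdegree \<phi> = k"
  unfolding cdegree_def
proof (rule Least_equality)
  fix l assume "\<phi> \<in> real_polys_le l"
  then show "k \<le> l" using assms(2,3) by (auto simp: real_polys_le_def in_keys_iff)
qed (fact assms(1))

lemma cdegree_attained:
  assumes "\<phi> \<in> real_polys" "\<phi> \<noteq> 0"
  shows "\<exists>\<alpha> \<beta>. mdeg \<alpha> = cdegree \<phi> \<and> mdeg \<beta> \<le> cdegree \<phi> \<and> Poly_Mapping.lookup \<phi> (\<alpha>, \<beta>) \<noteq> 0"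
proof (rule ccontr)
  let ?k = "cdegree \<phi>"
  assume n: "\<not> ?thesis"
  have m: "\<phi> \<in> real_polys_le ?k" using assms(1) by (rule cdegree_mem)
  have r: "\<And>z. ceval \<phi> z \<in> \<real>" using m by (simp add: real_polys_le_def)
  have s: "mdeg \<alpha> < ?k \<and> mdeg \<beta> < ?k" if "(\<alpha>, \<beta>) \<in> Poly_Mapping.keys \<phi>" for \<alpha> \<beta>
  proof -
    have c: "Poly_Mapping.lookup \<phi> (\<alpha>, \<beta>) \<noteq> 0" using that by (simp add: in_keys_iff)
    then have "Poly_Mapping.lookup \<phi> (\<beta>, \<alpha>) \<noteq> 0"
      using real_coeffs_hermitian[OF r, of \<alpha> \<beta>] by auto
    moreover have "mdeg \<alpha> \<le> ?k" "mdeg \<beta> \<le> ?k" using that m by (auto simp: real_polys_le_def)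
    ultimately show ?thesis using n c by (metis order_le_less)
  qed
  obtain p where "p \<in> Poly_Mapping.keys \<phi>" using assms(2) by (metis keys_eq_empty ex_in_conv)
  then have "?k > 0" using s by (metis not_gr_zero not_less_zero surj_pair)
  have "\<phi> \<in> real_polys_le (?k - 1)" using s r by (fastforce simp: real_polys_le_def)
  then have "?k \<le> ?k - 1" unfolding cdegree_def by (rule Least_le)
  with \<open>?k > 0\<close> show False by simp
qed

lemma riesz_real:
  fixes \<phi> :: "'n::finite cpoly"
  assumes "\<phi> \<in> real_polys" "y \<in> herm_families d"
  shows "riesz y \<phi> \<in> \<real>"
proof -
  let ?c = "Poly_Mapping.lookup \<phi>"
  have r: "\<And>z. ceval \<phi> z \<in> \<real>" using assms(1) by (auto simp: real_polys_def real_polys_le_def)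
  note h = real_coeffs_hermitian[OF r]
  have y: "cnj (y \<alpha> \<beta>) = y \<beta> \<alpha>" for \<alpha> \<beta> using assms(2) by (simp add: herm_families_def)
  have k: "(\<beta>, \<alpha>) \<in> Poly_Mapping.keys \<phi>" if "(\<alpha>, \<beta>) \<in> Poly_Mapping.keys \<phi>" for \<alpha> \<beta>
    using that h[of \<alpha> \<beta>] by (auto simp: in_keys_iff)
  have "cnj (riesz y \<phi>) = (\<Sum>(\<alpha>, \<beta>)\<in>Poly_Mapping.keys \<phi>. ?c (\<beta>, \<alpha>) * y \<beta> \<alpha>)"
    unfolding riesz_def by (auto simp: h y intro!: sum.cong)
  also have "\<dots> = riesz y \<phi>" unfolding riesz_def
    by (rule sum.reindex_bij_witness[of _ prod.swap prod.swap]) (auto intro: k)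
  finally show ?thesis by (simp add: Reals_cnj_iff)
qed

end

theory Submission
  imports Defs "HOL-Library.Function_Algebras"
begin

text \<open>Weak duality and evaluation at feasible points give \<open>\<rho>\<^sub>d\<^sup>* \<le> \<rho>\<^sub>d \<le> f\<^sup>o\<^sup>p\<^sup>t\<close>, so everything
  rests on a Positivstellensatz: a real polynomial \<open>F\<close> that is positive on \<open>K\<close> lies in the set \<open>M\<close>
  of all \<open>\<Sum>\<^sub>i \<sigma>\<^sub>i g\<^sub>i\<close> with Hermitian sums of squares \<open>\<sigma>\<^sub>i\<close>. Every real polynomial is a difference of
  Hermitian sums of squares, so \<open>M\<close> contains the ideal generated by \<open>s = R\<^sup>2 - \<Sum>\<^sub>j |z\<^sub>j|\<^sup>2\<close>, and \<open>M\<close>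
  is a module over the semiring \<open>T\<close> of all \<open>\<sigma> + s a\<close>. This semiring is archimedean because
  \<open>1/4 + R\<^sup>2 + Re (t z\<^sub>j) = |1/2 + t z\<^sub>j|\<^sup>2 + \<Sum>\<^sub>k\<^sub>\<noteq>\<^sub>j |z\<^sub>k|\<^sup>2 + s\<close> for \<open>|t| = 1\<close>. By the representation
  theorem of Kadison-Dubois type for modules over archimedean semirings, \<open>F \<notin> M\<close> would yield a
  ring homomorphism to the reals that is nonnegative on \<open>M\<close> and nonpositive at \<open>F\<close>. Such a
  homomorphism is the evaluation at a point of \<open>K\<close>.\<close>

section \<open>Modules over archimedean semirings\<close>

text \<open>\<open>A\<close> is the carrier of a subring and \<open>e\<close> embeds the reals into
  it; negatives arise as multiples by \<open>e (- 1)\<close>. Arbitrary squares are not assumed to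
  lie in \<open>T\<close>, because squares of real polynomials need not be Hermitian sums of
  squares.\<close>

locale archimedean_semiring =
  fixes A T :: "'a::comm_ring_1 set" and e :: "real \<Rightarrow> 'a"
  assumes e_add: "e (r + s) = e r + e s"
    and e_mult: "e (r * s) = e r * e s"
    and e_one: "e 1 = 1"
    and A_add: "a \<in> A \<Longrightarrow> b \<in> A \<Longrightarrow> a + b \<in> A"
    and A_mult: "a \<in> A \<Longrightarrow> b \<in> A \<Longrightarrow> a * b \<in> A"
    and e_in_A: "e r \<in> A"
    and T_subset: "T \<subseteq> A"
    and T_add: "a \<in> T \<Longrightarrow> b \<in> T \<Longrightarrow> a + b \<in> T"
    and T_mult: "a \<in> T \<Longrightarrow> b \<in> T \<Longrightarrow> a * b \<in> T"
    and e_in_T: "0 \<le> r \<Longrightarrow> e r \<in> T"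
    and archimedean: "a \<in> A \<Longrightarrow> \<exists>N. e N - a \<in> T"
begin

text \<open>Closure under products inside \<open>M\<close> is not demanded, so certificates stay
  linear in the constraints.\<close>

definition module :: "'a set \<Rightarrow> bool" where
  "module M \<longleftrightarrow> M \<subseteq> A \<and> 1 \<in> M \<and> (\<forall>a\<in>M. \<forall>b\<in>M. a + b \<in> M) \<and> (\<forall>t\<in>T. \<forall>a\<in>M. t * a \<in> M)"

lemma e_zero: "e 0 = 0"
  using e_add[of 0 0] by simp

lemma e_minus: "e (- r) = - e r"
  using e_add[of r "- r"] by (simp add: e_zero eq_neg_iff_add_eq_0 add.commute)

lemma e_diff: "e (r - s) = e r - e s"
  using e_add[of r "- s"] by (simp add: e_minus)

lemma A_minus: "a \<in> A \<Longrightarrow> - a \<in> A"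
  using A_mult[OF e_in_A[of "- 1"], of a] by (simp add: e_minus e_one)

lemma A_diff: "a \<in> A \<Longrightarrow> b \<in> A \<Longrightarrow> a - b \<in> A"
  using A_add[OF _ A_minus, of a b] by simp

lemma archimedean_pos:
  assumes "a \<in> A"
  obtains N where "N > 0" "e N - a \<in> T"
proof -
  obtain N where N: "e N - a \<in> T" using archimedean[OF assms] by blast
  have "e (max 1 N) - a = e (max 1 N - N) + (e N - a)" by (simp add: e_diff)
  then have "e (max 1 N) - a \<in> T" using T_add[OF e_in_T N, of "max 1 N - N"] by (metis diff_ge_0_iff_ge max.cobounded2)
  then show thesis using that[of "max 1 N"] by simp
qed

lemma moduleD:
  assumes "module M"
  shows "a \<in> M \<Longrightarrow> b \<in> M \<Longrightarrow> a + b \<in> M" "t \<in> T \<Longrightarrow> a \<in> M \<Longrightarrow> t * a \<in> M"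
    "a \<in> M \<Longrightarrow> a \<in> A" "t \<in> T \<Longrightarrow> t \<in> M"
  using assms unfolding module_def by (auto dest: bspec[of _ _ 1] simp: subset_iff) (metis mult.right_neutral)

text \<open>The set is the least module containing \<open>M\<close> and \<open>a\<close>. When it
  fails to be proper, \<open>- 1\<close> has the form \<open>m + t * a\<close>, an equation that the
  later arguments exploit.\<close>

lemma module_adjoin:
  assumes M: "module M" and a: "a \<in> A"
  shows "module {m + t * a |m t. m \<in> M \<and> t \<in> T}" (is "module ?M'")
    and "M \<subseteq> {m + t * a |m t. m \<in> M \<and> t \<in> T}"
    and "a \<in> {m + t * a |m t. m \<in> M \<and> t \<in> T}"
proof -
  have 0: "0 \<in> T" using e_in_T[of 0] by (simp add: e_zero)
  have 1: "1 \<in> T" using e_in_T[of 1] by (simp add: e_one)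
  show sub: "M \<subseteq> ?M'" using 0 by (force intro: exI[of _ 0])
  have "a = 0 + 1 * a" by simp
  then show "a \<in> ?M'" using 1 moduleD(4)[OF M 0] by blast
  show "module ?M'" unfolding module_def
  proof (intro conjI ballI)
    show "?M' \<subseteq> A" using moduleD(3)[OF M] T_subset a by (auto intro!: A_add A_mult)
    show "1 \<in> ?M'" using sub moduleD(4)[OF M 1] by blast
  next
    fix x y assume "x \<in> ?M'" "y \<in> ?M'"
    then obtain m t m' t' where *: "x = m + t * a" "m \<in> M" "t \<in> T" "y = m' + t' * a" "m' \<in> M" "t' \<in> T"
      by blast
    have "x + y = (m + m') + (t + t') * a" by (simp add: * algebra_simps)
    then show "x + y \<in> ?M'" using * moduleD(1)[OF M] T_add by blast
  next
    fix s x assume s: "s \<in> T" and "x \<in> ?M'"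
    then obtain m t where *: "x = m + t * a" "m \<in> M" "t \<in> T" by blast
    have "s * x = s * m + (s * t) * a" by (simp add: * algebra_simps)
    then show "s * x \<in> ?M'" using * s moduleD(2)[OF M] T_mult by blast
  qed
qed

lemma module_scale:
  assumes "module M" "c > 0" "e c * a \<in> M"
  shows "a \<in> M"
proof -
  have "e (1 / c) * (e c * a) \<in> M" using assms(2) by (intro moduleD(2)[OF assms(1) e_in_T assms(3)]) simp
  moreover have "e (1 / c) * e c = 1"
    using assms(2) e_mult[of "1 / c" c] by (simp add: e_one)
  ultimately show ?thesis by (simp add: mult.assoc[symmetric])
qed

text \<open>A negative constant in \<open>M\<close> could be rescaled by a positive one to
  \<open>- 1\<close>.\<close>

lemma module_neg_const:
  assumes "module M" "- 1 \<notin> M" "e r \<in> M"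
  shows "r \<ge> 0"
proof (rule ccontr)
  assume "\<not> r \<ge> 0"
  moreover have "e (- r) * (- 1) \<in> M" using assms(3) by (simp add: e_minus)
  ultimately show False using module_scale[OF assms(1), of "- r" "- 1"] assms(2) by simp
qed

text \<open>Starting from \<open>f + r \<in> M\<close>, the constant \<open>r\<close> is lowered in steps of \<open>1 / N\<close>, where
  \<open>N - t \<in> T\<close>: \<open>N (f + r - 1 / N) = (N - t) (f + r) + (f t - 1) + r t\<close>.\<close>

lemma module_mem_of_mult:
  assumes M: "module M" and f: "f \<in> A" and t: "t \<in> T" and ft: "f * t - 1 \<in> M"
  shows "f \<in> M"
proof -
  obtain N where N: "N > 0" "e N - t \<in> T" using archimedean_pos t T_subset by blast
  have step: "f + e (r - 1 / N) \<in> M" if "r \<ge> 0" "f + e r \<in> M" for r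
  proof (rule module_scale[OF M \<open>N > 0\<close>])
    have "(e N - t) * (f + e r) + (f * t - 1) + e r * t \<in> M"
      using moduleD(1)[OF M moduleD(1)[OF M moduleD(2)[OF M N(2) that(2)] ft]
          moduleD(4)[OF M T_mult[OF e_in_T[OF that(1)] t]]] .
    moreover have "e N * e (1 / N) = 1" using e_mult[of N "1 / N"] N by (simp add: e_one)
    ultimately show "e N * (f + e (r - 1 / N)) \<in> M" by (simp add: e_diff algebra_simps)
  qed
  \<comment> \<open>The number \<open>n\<close> bounds how many steps of size \<open>1 / N\<close>
    bring the constant \<open>r\<close> down to zero.\<close>
  have main: "f \<in> M" if "f + e r \<in> M" "0 \<le> r" "r \<le> real n / N" for n r
    using that
  proof (induction n arbitrary: r)
    case 0
    then show ?case by (simp add: e_zero)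
  next
    case (Suc n)
    note s = step[OF Suc.prems(2,1)]
    show ?case
    \<comment> \<open>In the last step \<open>r - 1 / N\<close> is at most zero, and the nonnegative
      constant \<open>1 / N - r\<close> is added back.\<close>
    proof (cases "r \<le> 1 / N")
      case True
      then have "e (1 / N - r) \<in> M" by (intro moduleD(4)[OF M] e_in_T) simp
      from moduleD(1)[OF M s this] show ?thesis by (simp add: e_diff)
    next
      case False
      with Suc.prems(3) Suc.IH[OF s] show ?thesis by (simp add: add_divide_distrib)
    qed
  qed
  obtain r where r: "r > 0" "e r - (- f) \<in> T" using archimedean_pos[OF A_minus[OF f]] by blast
  obtain n :: nat where "r * N \<le> real n" using real_arch_simple by blast
  then show ?thesis using main[of r n] r N moduleD(4)[OF M r(2)]
    by (simp add: field_simps)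
qed

text \<open>For a maximal proper \<open>M\<close>, the set \<open>J\<close> of all \<open>x\<close>
  with both \<open>x\<close> and \<open>- x\<close> in \<open>M\<close> is an ideal of
  \<open>A\<close>, and every \<open>a\<close> differs from exactly one real constant by an element
  of \<open>J\<close>. So \<open>A\<close> modulo \<open>J\<close> is the field of reals, and
  \<open>h\<close> is the quotient map.\<close>

lemma maximal_module_hom:
  assumes M: "module M" "- 1 \<notin> M"
    and max: "\<And>M'. module M' \<Longrightarrow> - 1 \<notin> M' \<Longrightarrow> M \<subseteq> M' \<Longrightarrow> M' = M"
  obtains h where "\<And>a b. a \<in> A \<Longrightarrow> b \<in> A \<Longrightarrow> h (a + b) = h a + h b"
    "\<And>a b. a \<in> A \<Longrightarrow> b \<in> A \<Longrightarrow> h (a * b) = h a * h b"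
    "\<And>r. h (e r) = r" "\<And>a. a \<in> M \<Longrightarrow> h a \<ge> (0 :: real)"
proof -
  have adjoin: "\<exists>m\<in>M. \<exists>t\<in>T. - 1 = m + t * a" if "a \<in> A" "a \<notin> M" for a
    using max[OF module_adjoin(1)[OF M(1) that(1)] _ module_adjoin(2)[OF M(1) that(1)]]
      module_adjoin(3)[OF M(1) that(1)] that by blast
  have closed: "a \<in> M" if a: "a \<in> A" and lim: "\<And>\<epsilon>. \<epsilon> > 0 \<Longrightarrow> a + e \<epsilon> \<in> M" for a
  proof (rule ccontr)
    assume "a \<notin> M"
    then obtain m t where mt: "m \<in> M" "t \<in> T" "- 1 = m + t * a" using adjoin a by blast
    obtain N where N: "N > 0" "e N - t \<in> T" using archimedean_pos mt T_subset by blast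
    \<comment> \<open>Replacing \<open>a\<close> by \<open>a + e \<epsilon>\<close> adds
      \<open>t * e \<epsilon>\<close>; a further \<open>e \<epsilon> * (e N - t)\<close> turns this
      into the constant \<open>\<epsilon> * N\<close>. Its value 1/2 lifts \<open>- 1\<close> only
      to -1/2, which is still negative.\<close>
    define \<epsilon> where "\<epsilon> = 1 / (2 * N)"
    have "\<epsilon> > 0" using N by (simp add: \<epsilon>_def)
    then have "m + t * (a + e \<epsilon>) + e \<epsilon> * (e N - t) \<in> M"
      using moduleD(1)[OF M(1) moduleD(1)[OF M(1) mt(1) moduleD(2)[OF M(1) mt(2) lim]]
          moduleD(4)[OF M(1) T_mult[OF e_in_T N(2)]]] by simp
    also have "m + t * (a + e \<epsilon>) + e \<epsilon> * (e N - t) = (m + t * a) + e \<epsilon> * e N"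
      by (simp add: algebra_simps)
    also have "\<dots> = e (- 1 / 2)"
      using N by (simp add: mt(3)[symmetric] e_mult[symmetric] \<epsilon>_def) (simp add: e_one[symmetric] e_diff[symmetric])
    finally show False using module_neg_const[OF M] by fastforce
  qed
  define J where "J = {x \<in> M. - x \<in> M}"
  \<comment> \<open>The constant is the supremum \<open>l\<close> of the cut of all \<open>r\<close>
    with \<open>a - e r \<in> M\<close>. By \<open>closed\<close> it is attained; maximality then
    puts \<open>e l - a\<close> into \<open>M\<close> as well.\<close>
  have ex: "\<exists>r. a - e r \<in> J" if a: "a \<in> A" for a
  proof -
    define S where "S = {r. a - e r \<in> M}"
    obtain N where N: "e N - (- a) \<in> T" using archimedean[OF A_minus[OF a]] by blast
    then have ne: "- N \<in> S" using moduleD(4)[OF M(1) N] by (simp add: S_def e_minus add.commute)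
    obtain N' where N': "e N' - a \<in> T" using archimedean[OF a] by blast
    have bdd: "bdd_above S"
    proof (rule bdd_aboveI)
      fix r assume "r \<in> S"
      then have "(e N' - a) + (a - e r) \<in> M"
        by (intro moduleD(1)[OF M(1)] moduleD(4)[OF M(1) N']) (simp add: S_def)
      then have "e (N' - r) \<in> M" by (simp add: e_diff)
      then show "r \<le> N'" using module_neg_const[OF M] by fastforce
    qed
    define l where "l = Sup S"
    have "a - e l \<in> M"
    proof (rule closed)
      fix \<epsilon> :: real assume "\<epsilon> > 0"
      then obtain r where r: "r \<in> S" "l - \<epsilon> < r"
        using less_cSup_iff[of S "l - \<epsilon>"] ne bdd by (auto simp: l_def)
      then have "(a - e r) + e (r - (l - \<epsilon>)) \<in> M"
        using moduleD(1)[OF M(1) _ moduleD(4)[OF M(1) e_in_T]] by (simp add: S_def)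
      then show "a - e l + e \<epsilon> \<in> M" by (simp add: e_diff e_add algebra_simps)
    qed (auto intro: A_diff a e_in_A)
    moreover have "e l - a \<in> M"
    proof (rule closed)
      fix \<epsilon> :: real assume "\<epsilon> > 0"
      have "l + \<epsilon> \<notin> S" using cSup_upper[OF _ bdd, of "l + \<epsilon>"] \<open>\<epsilon> > 0\<close> by (auto simp: l_def)
      then obtain m t where mt: "m \<in> M" "t \<in> T" "- 1 = m + t * (a - e (l + \<epsilon>))"
        using adjoin[OF A_diff[OF a e_in_A]] unfolding S_def by blast
      \<comment> \<open>The equation for \<open>- 1\<close> is rearranged into the hypothesis of
        \<open>module_mem_of_mult\<close>.\<close>
      have "(e (l + \<epsilon>) - a) * t - 1 = m"
        by (simp add: add_implies_diff[OF mt(3)[symmetric]] algebra_simps)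
      with mt(1) have "e (l + \<epsilon>) - a \<in> M"
        using module_mem_of_mult[OF M(1) A_diff[OF e_in_A a] mt(2)] by simp
      then show "e l - a + e \<epsilon> \<in> M" by (simp add: e_add algebra_simps)
    qed (auto intro: A_diff a e_in_A)
    ultimately show ?thesis by (auto simp: J_def)
  qed
  then obtain h where h: "\<And>a. a \<in> A \<Longrightarrow> a - e (h a) \<in> J" by metis
  have J_minus: "- x \<in> J" if "x \<in> J" for x using that by (simp add: J_def)
  have J_add: "x + y \<in> J" if "x \<in> J" "y \<in> J" for x y
    using that moduleD(1)[OF M(1), of x y] moduleD(1)[OF M(1), of "- x" "- y"] by (simp add: J_def)
  have J_mult: "a * x \<in> J" if x: "x \<in> J" and a: "a \<in> A" for a x
  proof -
    obtain N where N: "N > 0" "e N - (- a) \<in> T" using archimedean_pos[OF A_minus[OF a]] by blast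
    have *: "a * y \<in> M" if "y \<in> J" for y
    proof -
      have y: "y \<in> M" "- y \<in> M" using that by (auto simp: J_def)
      \<comment> \<open>This element equals \<open>a * y\<close>. Both multipliers
        \<open>N + a\<close> and \<open>N\<close> lie in \<open>T\<close>, whereas \<open>a\<close>
        itself need not.\<close>
      have "(e N - (- a)) * y + e N * (- y) \<in> M"
        using moduleD(1)[OF M(1) moduleD(2)[OF M(1) N(2) y(1)]
            moduleD(2)[OF M(1) e_in_T[OF less_imp_le[OF N(1)]] y(2)]] .
      then show ?thesis by (simp add: algebra_simps)
    qed
    show ?thesis using *[OF x] *[OF J_minus[OF x]] by (simp add: J_def)
  qed
  have h_eq: "h a = r" if "a \<in> A" "a - e r \<in> J" for a r
  proof -
    \<comment> \<open>Two candidate constants differ by a constant in \<open>J\<close>, which is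
      forced to be zero because both of its signs lie in the proper module \<open>M\<close>.\<close>
    have "(a - e r) + - (a - e (h a)) \<in> J" using that h by (intro J_add J_minus) auto
    then have *: "e (h a - r) \<in> J" by (simp add: e_diff)
    then have "e (r - h a) \<in> J" using J_minus[OF *] by (simp add: e_diff)
    with * show ?thesis using module_neg_const[OF M, of "h a - r"] module_neg_const[OF M, of "r - h a"]
      by (auto simp: J_def)
  qed
  show thesis
  proof (rule that[of h])
    fix a b assume ab: "a \<in> A" "b \<in> A"
    have "(a - e (h a)) + (b - e (h b)) \<in> J" by (intro J_add h ab)
    then show "h (a + b) = h a + h b"
      by (intro h_eq A_add ab) (simp add: e_add algebra_simps)
    \<comment> \<open>The mixed terms cancel and leave \<open>a * b - e (h a * h b)\<close>.\<close>
    have "b * (a - e (h a)) + e (h a) * (b - e (h b)) \<in> J"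
      by (intro J_add J_mult h e_in_A ab)
    then show "h (a * b) = h a * h b"
      by (intro h_eq A_mult ab) (simp add: e_mult algebra_simps)
  next
    fix r
    have "e 0 \<in> M" by (intro moduleD(4)[OF M(1)] e_in_T) simp
    then show "h (e r) = r" by (intro h_eq) (auto simp: J_def e_zero e_in_A)
  next
    fix a assume a: "a \<in> M"
    then have "a + - (a - e (h a)) \<in> M" using h[OF moduleD(3)[OF M(1) a]]
      by (intro moduleD(1)[OF M(1)]) (auto simp: J_def)
    then show "h a \<ge> 0" using module_neg_const[OF M] by simp
  qed
qed

text \<open>Adjoining \<open>- f\<close> keeps the module proper: \<open>- 1 = m - t * f\<close>
  would give \<open>f * t - 1 \<in> M\<close> and hence \<open>f \<in> M\<close>. Zorn's lemma
  provides a maximal proper module above it, and the homomorphism of that module is nonnegative at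
  \<open>- f\<close>.\<close>

theorem representation:
  assumes M: "module M" and f: "f \<in> A" "f \<notin> M"
  obtains h where "\<And>a b. a \<in> A \<Longrightarrow> b \<in> A \<Longrightarrow> h (a + b) = h a + h b"
    "\<And>a b. a \<in> A \<Longrightarrow> b \<in> A \<Longrightarrow> h (a * b) = h a * h b"
    "\<And>r. h (e r) = r" "\<And>a. a \<in> M \<Longrightarrow> h a \<ge> (0 :: real)" "h f \<le> 0"
proof -
  define M' where "M' = {m + t * (- f) |m t. m \<in> M \<and> t \<in> T}"
  note M' = module_adjoin[OF M A_minus[OF f(1)], folded M'_def]
  have "- 1 \<notin> M'"
  proof
    assume "- 1 \<in> M'"
    then obtain m t where mt: "m \<in> M" "t \<in> T" "- 1 = m + t * (- f)" by (auto simp: M'_def)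
    have "f * t - 1 = m" by (simp add: add_implies_diff[OF mt(3)[symmetric]] algebra_simps)
    then show False using module_mem_of_mult[OF M f(1) mt(2)] mt f(2) by simp
  qed
  define \<C> where "\<C> = {N. module N \<and> - 1 \<notin> N \<and> M' \<subseteq> N}"
  have "\<C> \<noteq> {}" using M' \<open>- 1 \<notin> M'\<close> by (auto simp: \<C>_def)
  moreover have "\<Union>C \<in> \<C>" if C: "C \<noteq> {}" "subset.chain \<C> C" for C
  proof -
    have sub: "N \<in> \<C>" if "N \<in> C" for N using C that by (auto simp: subset.chain_def)
    have mod: "module N" "- 1 \<notin> N" "M' \<subseteq> N" if "N \<in> C" for N
      using sub[OF that] by (auto simp: \<C>_def)
    have "module (\<Union>C)" unfolding module_def
    proof (intro conjI ballI)
      show "\<Union>C \<subseteq> A" using mod moduleD(3) by blast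
      show "1 \<in> \<Union>C" using C(1) mod by (auto simp: module_def)
    next
      fix a b assume "a \<in> \<Union>C" "b \<in> \<Union>C"
      then obtain X Y where XY: "a \<in> X" "X \<in> C" "b \<in> Y" "Y \<in> C" by blast
      then have "X \<subseteq> Y \<or> Y \<subseteq> X" using C(2) by (auto simp: subset.chain_def)
      then show "a + b \<in> \<Union>C" using XY mod moduleD(1) by blast
    next
      fix t a assume "t \<in> T" "a \<in> \<Union>C"
      then show "t * a \<in> \<Union>C" using mod moduleD(2) by blast
    qed
    moreover have "M' \<subseteq> \<Union>C" using mod(3) C(1) by blast
    ultimately show ?thesis using mod(2) by (auto simp: \<C>_def)
  qed
  ultimately obtain N where N: "N \<in> \<C>" "\<forall>X\<in>\<C>. N \<subseteq> X \<longrightarrow> X = N"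
    using subset_Zorn_nonempty[of \<C>] by blast
  have NM: "module N" "- 1 \<notin> N" "M' \<subseteq> N" using N(1) by (auto simp: \<C>_def)
  have "\<And>X. module X \<Longrightarrow> - 1 \<notin> X \<Longrightarrow> N \<subseteq> X \<Longrightarrow> X = N" using N(2) NM(3) by (auto simp: \<C>_def)
  from maximal_module_hom[OF NM(1,2) this] obtain h where
    h: "\<And>a b. a \<in> A \<Longrightarrow> b \<in> A \<Longrightarrow> h (a + b) = h a + h b"
    "\<And>a b. a \<in> A \<Longrightarrow> b \<in> A \<Longrightarrow> h (a * b) = h a * h b"
    "\<And>r. h (e r) = r" "\<And>a. a \<in> N \<Longrightarrow> h a \<ge> (0 :: real)" by blast
  have "h (- f) \<ge> 0" using M'(3) NM(3) h(4) by blast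
  moreover have "h f + h (- f) = 0" using h(1)[OF f(1) A_minus[OF f(1)]] h(3)[of 0] by (simp add: e_zero)
  ultimately have "h f \<le> 0" by linarith
  moreover have "M \<subseteq> N" using M'(2) NM(3) by blast
  ultimately show thesis using that[of h] h by blast
qed

end

section \<open>Hermitian sums of squares\<close>

lemma mdeg_add: "mdeg (\<alpha> + \<beta>) = mdeg \<alpha> + mdeg \<beta>"
  by (simp add: mdeg_def sum.distrib)

lemma mdeg_zero [simp]: "mdeg 0 = 0"
  by (simp add: mdeg_def)

lemma mdeg_axis [simp]: "mdeg (axis j k) = k"
  by (simp add: mdeg_def axis_def if_distrib sum.delta)

lemma zpow_add: "zpow z (\<alpha> + \<beta>) = zpow z \<alpha> * zpow z \<beta>"
  by (simp add: zpow_def power_add prod.distrib)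

lemma zpow_zero [simp]: "zpow z 0 = 1"
  by (simp add: zpow_def)

lemma zpow_axis_one [simp]: "zpow z (axis j (Suc 0)) = z $ j"
proof -
  have "zpow z (axis j (Suc 0)) = (\<Prod>i\<in>UNIV. if i = j then z $ i else 1)"
    unfolding zpow_def axis_def by (rule prod.cong) auto
  then show ?thesis by (simp add: prod.delta)
qed

text \<open>The exponents \<open>a x\<close> may repeat, while the definition allows one coefficient
  per exponent; the coefficients are therefore summed over the fibres of \<open>a\<close>.\<close>

lemma holomorphic_polys_le_sum:
  fixes a :: "'i \<Rightarrow> nat ^ 'n::finite"
  assumes "finite S" "\<And>x. x \<in> S \<Longrightarrow> mdeg (a x) \<le> d"
  shows "(\<lambda>z. \<Sum>x\<in>S. c x * zpow z (a x)) \<in> holomorphic_polys_le d"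
proof -
  have "(\<Sum>x\<in>S. c x * zpow z (a x))
      = (\<Sum>\<alpha> | mdeg \<alpha> \<le> d. (\<Sum>x\<in>{x \<in> S. a x = \<alpha>}. c x) * zpow z \<alpha>)" for z
  proof -
    have "(\<Sum>\<alpha> | mdeg \<alpha> \<le> d. (\<Sum>x\<in>{x \<in> S. a x = \<alpha>}. c x) * zpow z \<alpha>)
        = (\<Sum>\<alpha> | mdeg \<alpha> \<le> d. \<Sum>x\<in>{x \<in> S. a x = \<alpha>}. c x * zpow z (a x))"
      by (simp add: sum_distrib_right)
    also have "\<dots> = (\<Sum>x\<in>S. c x * zpow z (a x))"
      using assms by (intro sum.group finite_mdeg_le) auto
    finally show ?thesis by simp
  qed
  then show ?thesis unfolding holomorphic_polys_le_def by (intro CollectI exI ext)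
qed

lemma holomorphic_polys_le_mono:
  assumes "p \<in> holomorphic_polys_le d" "d \<le> e"
  shows "p \<in> holomorphic_polys_le e"
proof -
  obtain c where "p = (\<lambda>z. \<Sum>\<alpha> | mdeg \<alpha> \<le> d. c \<alpha> * zpow z \<alpha>)"
    using assms(1) by (auto simp: holomorphic_polys_le_def)
  then show ?thesis using assms(2) by (auto intro!: holomorphic_polys_le_sum finite_mdeg_le)
qed

lemma holomorphic_polys_le_mult:
  assumes "p \<in> holomorphic_polys_le d" "q \<in> holomorphic_polys_le e"
  shows "(\<lambda>z. p z * q z) \<in> holomorphic_polys_le (d + e)"
proof -
  obtain b c where p: "p = (\<lambda>z. \<Sum>\<alpha> | mdeg \<alpha> \<le> d. b \<alpha> * zpow z \<alpha>)"
    and q: "q = (\<lambda>z. \<Sum>\<beta> | mdeg \<beta> \<le> e. c \<beta> * zpow z \<beta>)"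
    using assms by (auto simp: holomorphic_polys_le_def)
  have "(\<lambda>z. p z * q z) = (\<lambda>z. \<Sum>x\<in>{\<alpha>. mdeg \<alpha> \<le> d} \<times> {\<beta>. mdeg \<beta> \<le> e}.
      (b (fst x) * c (snd x)) * zpow z (fst x + snd x))"
    by (simp add: p q sum_product sum.cartesian_product zpow_add case_prod_beta mult_ac)
  also have "\<dots> \<in> holomorphic_polys_le (d + e)"
    by (rule holomorphic_polys_le_sum)
      (auto simp: mdeg_add intro: add_mono finite_cartesian_product finite_mdeg_le)
  finally show ?thesis .
qed

lemma holomorphic_polys_le_affine:
  "(\<lambda>z. c + t * z $ j) \<in> holomorphic_polys_le 1"
proof -
  \<comment> \<open>The two truth values index the linear and the constant term.\<close>
  have "(\<lambda>z. \<Sum>x\<in>UNIV. (if x then t else c) * zpow z (if x then axis j 1 else 0))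
      \<in> holomorphic_polys_le 1"
    by (rule holomorphic_polys_le_sum) auto
  then show ?thesis by (simp add: UNIV_bool)
qed

lemma holomorphic_polys_le_const: "(\<lambda>z. c) \<in> holomorphic_polys_le d"
  using holomorphic_polys_le_sum[of "{()}" "\<lambda>_. 0" d "\<lambda>_. c"] by simp

lemma herm_sosI:
  assumes "finite S" "\<And>x. x \<in> S \<Longrightarrow> p x \<in> holomorphic_polys_le d"
  shows "(\<lambda>z. \<Sum>x\<in>S. (cmod (p x z))\<^sup>2) \<in> herm_sos d"
\<comment> \<open>The definition asks for at least one square, so the empty sum is written as the
  single square of the zero polynomial.\<close>
proof (cases "S = {}")
  case True
  then show ?thesis unfolding herm_sos_def
    by (auto intro!: exI[of _ 1] exI[of _ "\<lambda>_ _. 0"] holomorphic_polys_le_const)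
next
  case False
  obtain b where b: "bij_betw b {1..card S} S" using ex_bij_betw_nat_finite_1 assms(1) by blast
  have "card S \<ge> 1" using False assms(1) by (simp add: Suc_leI card_gt_0_iff)
  moreover have "\<forall>j\<in>{1..card S}. p (b j) \<in> holomorphic_polys_le d"
    using b assms(2) by (auto simp: bij_betw_def)
  moreover have "(\<lambda>z. \<Sum>x\<in>S. (cmod (p x z))\<^sup>2) = (\<lambda>z. \<Sum>j=1..card S. (cmod (p (b j) z))\<^sup>2)"
    by (intro ext sum.reindex_bij_betw[OF b, symmetric])
  ultimately show ?thesis unfolding herm_sos_def by (intro CollectI exI conjI)
qed

lemma herm_sosE:
  assumes "\<sigma> \<in> herm_sos d"
  obtains r p where "\<forall>j\<in>{1..r::nat}. p j \<in> holomorphic_polys_le d"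
    "\<sigma> = (\<lambda>z. \<Sum>j=1..r. (cmod (p j z))\<^sup>2)"
  using assms unfolding herm_sos_def by blast

lemma herm_sos_mono: "\<sigma> \<in> herm_sos d \<Longrightarrow> d \<le> e \<Longrightarrow> \<sigma> \<in> herm_sos e"
  unfolding herm_sos_def using holomorphic_polys_le_mono by blast

lemma herm_sos_add:
  assumes "\<sigma> \<in> herm_sos d" "\<tau> \<in> herm_sos d"
  shows "\<sigma> + \<tau> \<in> herm_sos d"
proof -
  obtain r p where p: "\<forall>j\<in>{1..r::nat}. p j \<in> holomorphic_polys_le d"
    "\<sigma> = (\<lambda>z. \<Sum>j=1..r. (cmod (p j z))\<^sup>2)" by (rule herm_sosE[OF assms(1)])
  obtain s q where q: "\<forall>j\<in>{1..s::nat}. q j \<in> holomorphic_polys_le d"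
    "\<tau> = (\<lambda>z. \<Sum>j=1..s. (cmod (q j z))\<^sup>2)" by (rule herm_sosE[OF assms(2)])
  have "(\<lambda>z. \<Sum>x\<in>{1..r} <+> {1..s}. (cmod (case_sum p q x z))\<^sup>2) \<in> herm_sos d"
    using p q by (intro herm_sosI) auto
  moreover have "\<sigma> + \<tau> = (\<lambda>z. \<Sum>x\<in>{1..r} <+> {1..s}. (cmod (case_sum p q x z))\<^sup>2)"
    by (simp add: p(2) q(2) sum.Plus fun_eq_iff)
  ultimately show ?thesis by simp
qed

text \<open>The reason is \<open>|p|^2 |q|^2 = |p q|^2\<close>, where the product of holomorphic
  polynomials is again holomorphic.\<close>

lemma herm_sos_mult:
  assumes "\<sigma> \<in> herm_sos d" "\<tau> \<in> herm_sos e"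
  shows "\<sigma> * \<tau> \<in> herm_sos (d + e)"
proof -
  obtain r p where p: "\<forall>j\<in>{1..r::nat}. p j \<in> holomorphic_polys_le d"
    "\<sigma> = (\<lambda>z. \<Sum>j=1..r. (cmod (p j z))\<^sup>2)" by (rule herm_sosE[OF assms(1)])
  obtain s q where q: "\<forall>j\<in>{1..s::nat}. q j \<in> holomorphic_polys_le e"
    "\<tau> = (\<lambda>z. \<Sum>j=1..s. (cmod (q j z))\<^sup>2)" by (rule herm_sosE[OF assms(2)])
  have "(\<lambda>z. \<Sum>x\<in>{1..r} \<times> {1..s}. (cmod (p (fst x) z * q (snd x) z))\<^sup>2) \<in> herm_sos (d + e)"
    using p q by (intro herm_sosI[where p = "\<lambda>x z. p (fst x) z * q (snd x) z"]
        holomorphic_polys_le_mult) auto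
  moreover have "\<sigma> * \<tau> = (\<lambda>z. \<Sum>x\<in>{1..r} \<times> {1..s}. (cmod (p (fst x) z * q (snd x) z))\<^sup>2)"
    by (simp add: p(2) q(2) sum_product sum.cartesian_product fun_eq_iff norm_mult
        power_mult_distrib case_prod_beta)
  ultimately show ?thesis by simp
qed

text \<open>Degree bounds are forgotten here to obtain a semiring; they return in
  \<open>sos_value_ge\<close>.\<close>

definition hsos :: "(complex ^ 'n::finite \<Rightarrow> real) set" where
  "hsos = (\<Union>d. herm_sos d)"

lemma hsos_add: "\<sigma> \<in> hsos \<Longrightarrow> \<tau> \<in> hsos \<Longrightarrow> \<sigma> + \<tau> \<in> hsos"
  unfolding hsos_def by (auto intro: herm_sos_add herm_sos_mono[OF _ max.cobounded1] herm_sos_mono[OF _ max.cobounded2])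

lemma hsos_mult: "\<sigma> \<in> hsos \<Longrightarrow> \<tau> \<in> hsos \<Longrightarrow> \<sigma> * \<tau> \<in> hsos"
  unfolding hsos_def using herm_sos_mult by blast

lemma hsos_const: "0 \<le> c \<Longrightarrow> (\<lambda>_. c) \<in> hsos"
  using herm_sosI[of "{()}" "\<lambda>_ _. complex_of_real (sqrt c)" 0]
  by (auto simp: hsos_def holomorphic_polys_le_const)

lemma hsos_zero: "0 \<in> hsos"
  using hsos_const[of 0] by (simp add: zero_fun_def)

lemma hsos_affine: "(\<lambda>z. (cmod (c + t * z $ j))\<^sup>2) \<in> hsos"
  using herm_sosI[of "{()}" "\<lambda>_ z. c + t * z $ j" 1]
    holomorphic_polys_le_affine[of c t j]
  by (auto simp: hsos_def)

lemma hsos_sum_coords: "(\<lambda>z. \<Sum>k\<in>S. (cmod (z $ k))\<^sup>2) \<in> hsos"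
  using herm_sosI[of S "\<lambda>k z. z $ k" 1] holomorphic_polys_le_affine[of 0 1]
  by (auto simp: hsos_def)

section \<open>Real polynomial functions in the real and imaginary parts of the coordinates\<close>

lemma real_polynomial_function_coord:
  "real_polynomial_function (\<lambda>z::complex ^ 'n::finite. Re (z $ j))"
  "real_polynomial_function (\<lambda>z::complex ^ 'n::finite. Im (z $ j))"
  by (intro real_polynomial_function.intros(1) bounded_linear_compose[OF bounded_linear_Re]
      bounded_linear_compose[OF bounded_linear_Im] bounded_linear_vec_nth)+

lemma linear_complex_vec:
  fixes f :: "complex ^ 'n::finite \<Rightarrow> real"
  assumes "linear f"
  shows "f z = (\<Sum>j\<in>UNIV. Re (z $ j) * f (axis j 1) + Im (z $ j) * f (axis j \<i>))"
proof -
  have "z = (\<Sum>j\<in>UNIV. Re (z $ j) *\<^sub>R axis j 1 + Im (z $ j) *\<^sub>R axis j \<i>)"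
  proof (subst vec_eq_iff, rule allI)
    fix i
    have "(\<Sum>j\<in>UNIV. Re (z $ j) *\<^sub>R axis j 1 + Im (z $ j) *\<^sub>R axis j \<i>) $ i
        = (\<Sum>j\<in>UNIV. if j = i then z $ j else 0)"
      unfolding sum_component
      by (rule sum.cong) (auto simp: axis_def complex_eq_iff)
    then show "z $ i = (\<Sum>j\<in>UNIV. Re (z $ j) *\<^sub>R axis j 1 + Im (z $ j) *\<^sub>R axis j \<i>) $ i" by simp
  qed
  then have "f z = f (\<Sum>j\<in>UNIV. Re (z $ j) *\<^sub>R axis j 1 + Im (z $ j) *\<^sub>R axis j \<i>)" by simp
  also have "\<dots> = (\<Sum>j\<in>UNIV. Re (z $ j) * f (axis j 1) + Im (z $ j) * f (axis j \<i>))"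
    by (simp add: linear_sum[OF assms] linear_add[OF assms] linear_scale[OF assms])
  finally show ?thesis .
qed

text \<open>The atoms of \<open>real_polynomial_function\<close> are all bounded linear functionals;
  their expansion in coordinates leaves only real and imaginary parts. Sums and products are those
  of the function ring, in which \<open>A\<close>, \<open>T\<close> and \<open>M\<close> live
  below.\<close>

lemma real_polynomial_function_coord_induct [consumes 1, case_names const Re Im add mult]:
  fixes p :: "complex ^ 'n::finite \<Rightarrow> real"
  assumes "real_polynomial_function p"
    and const: "\<And>c. P (\<lambda>_. c)"
    and Re: "\<And>j. P (\<lambda>z. Re (z $ j))"
    and Im: "\<And>j. P (\<lambda>z. Im (z $ j))"
    and add: "\<And>f g. real_polynomial_function f \<Longrightarrow> P f \<Longrightarrow> real_polynomial_function g \<Longrightarrow> P g \<Longrightarrow> P (f + g)"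
    and mult: "\<And>f g. real_polynomial_function f \<Longrightarrow> P f \<Longrightarrow> real_polynomial_function g \<Longrightarrow> P g \<Longrightarrow> P (f * g)"
  shows "P p"
  using assms(1)
proof (induction rule: real_polynomial_function.induct)
  case (linear f)
  let ?t = "\<lambda>j z. Re (z $ j) * f (axis j 1) + Im (z $ j) * f (axis j \<i>)"
  have t: "real_polynomial_function (?t j) \<and> P (?t j)" for j
  proof -
    have m: "real_polynomial_function q \<Longrightarrow> P q \<Longrightarrow> P (\<lambda>z. q z * c)" for q c
      using mult[of q "\<lambda>_. c", OF _ _ real_polynomial_function.intros(2) const] by (simp add: times_fun_def)
    note Q = real_polynomial_function.intros(4)[OF _ real_polynomial_function.intros(2)]
    have "P ((\<lambda>z. Re (z $ j) * f (axis j 1)) + (\<lambda>z. Im (z $ j) * f (axis j \<i>)))"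
      by (intro add m Re Im Q real_polynomial_function_coord)
    moreover have "real_polynomial_function (?t j)"
      by (intro real_polynomial_function.intros(3) Q real_polynomial_function_coord)
    ultimately show ?thesis by (simp add: plus_fun_def)
  qed
  \<comment> \<open>Polynomiality is carried through the induction because \<open>add\<close>
    requires it of both summands.\<close>
  have "real_polynomial_function (\<lambda>z. \<Sum>j\<in>S. ?t j z) \<and> P (\<lambda>z. \<Sum>j\<in>S. ?t j z)" if "finite S" for S
    using that
  proof (induction rule: finite_induct)
    case empty
    then show ?case using const[of 0] by auto
  next
    case (insert j S)
    then show ?case using t[of j] add[of "?t j" "\<lambda>z. \<Sum>j\<in>S. ?t j z"]
      by (auto simp: plus_fun_def)
  qed
  from this[OF finite_class.finite_UNIV] have "P (\<lambda>z. \<Sum>j\<in>UNIV. ?t j z)" ..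
  moreover have "(\<lambda>z. \<Sum>j\<in>UNIV. ?t j z) = f"
    using linear_complex_vec[OF bounded_linear.linear[OF linear], symmetric] by (rule ext)
  ultimately show ?case by (rule subst[rotated])
next
  case (const c)
  then show ?case by (rule assms(2))
next
  case (add f g)
  then show ?case using assms(5)[of f g] by (simp add: plus_fun_def)
next
  case (mult f g)
  then show ?case using assms(6)[of f g] by (simp add: times_fun_def)
qed

text \<open>Subtracting the same identity at \<open>- w\<close> isolates the linear term, which is
  the polarization; the identity also yields the bound on coordinates in
  \<open>half_coord_in_T\<close>.\<close>

lemma cmod_half_plus: "(cmod (1 / 2 + w))\<^sup>2 = 1 / 4 + Re w + (cmod w)\<^sup>2"
  unfolding cmod_power2 by (simp add: power2_eq_square algebra_simps)

text \<open>The real coordinates are differences of squares by polarization.\<close>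

lemma real_polynomial_function_diff_hsos:
  fixes p :: "complex ^ 'n::finite \<Rightarrow> real"
  assumes "real_polynomial_function p"
  shows "\<exists>\<sigma>\<in>hsos. \<exists>\<tau>\<in>hsos. p = \<sigma> - \<tau>"
  using assms
proof (induction rule: real_polynomial_function_coord_induct)
  case (const c)
  have "(\<lambda>_. c) = (\<lambda>_. max c 0) - (\<lambda>_. max (- c) 0)" by (auto simp: fun_eq_iff)
  moreover have "(\<lambda>_. max c 0) \<in> hsos" "(\<lambda>_. max (- c) 0) \<in> hsos"
    by (intro hsos_const; simp)+
  ultimately show ?case by blast
next
  case (Re j)
  have "(\<lambda>z. Re (z $ j)) = (\<lambda>z. (cmod (1 / 2 + 1 / 2 * z $ j))\<^sup>2) - (\<lambda>z. (cmod (1 / 2 + (- 1 / 2) * z $ j))\<^sup>2)"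
    unfolding cmod_half_plus by (auto simp: fun_eq_iff)
  then show ?case using hsos_affine by blast
next
  case (Im j)
  have "(\<lambda>z. Im (z $ j)) = (\<lambda>z. (cmod (1 / 2 + (- \<i> / 2) * z $ j))\<^sup>2) - (\<lambda>z. (cmod (1 / 2 + \<i> / 2 * z $ j))\<^sup>2)"
    unfolding cmod_half_plus by (auto simp: fun_eq_iff norm_mult)
  then show ?case using hsos_affine by blast
next
  case (add f g)
  then obtain a b c d where "a \<in> hsos" "b \<in> hsos" "c \<in> hsos" "d \<in> hsos" "f = a - b" "g = c - d"
    by blast
  then show ?case by (intro bexI[of _ "a + c"] bexI[of _ "b + d"] hsos_add) auto
next
  case (mult f g)
  then obtain a b c d where "a \<in> hsos" "b \<in> hsos" "c \<in> hsos" "d \<in> hsos" "f = a - b" "g = c - d"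
    by blast
  then show ?case
    by (intro bexI[of _ "a * c + b * d"] bexI[of _ "a * d + b * c"] hsos_add hsos_mult)
      (auto simp: algebra_simps)
qed

text \<open>A bridge from complex expressions such as \<open>zpow\<close> and \<open>ceval\<close>
  to the real-valued \<open>real_polynomial_function\<close>. Unlike holomorphy, the notion is
  stable under \<open>cnj\<close>.\<close>

definition complex_polynomial_function :: "(complex ^ 'n::finite \<Rightarrow> complex) \<Rightarrow> bool" where
  "complex_polynomial_function h \<longleftrightarrow>
    real_polynomial_function (\<lambda>z. Re (h z)) \<and> real_polynomial_function (\<lambda>z. Im (h z))"

lemma complex_polynomial_function_intros:
  "complex_polynomial_function (\<lambda>z. c)"
  "complex_polynomial_function (\<lambda>z. z $ j)"
  "complex_polynomial_function h \<Longrightarrow> complex_polynomial_function (\<lambda>z. cnj (h z))"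
  "complex_polynomial_function h \<Longrightarrow> complex_polynomial_function k
    \<Longrightarrow> complex_polynomial_function (\<lambda>z. h z * k z)"
  by (auto simp: complex_polynomial_function_def intro: real_polynomial_function_coord)

lemma complex_polynomial_function_sum:
  "finite S \<Longrightarrow> (\<And>x. x \<in> S \<Longrightarrow> complex_polynomial_function (h x))
    \<Longrightarrow> complex_polynomial_function (\<lambda>z. \<Sum>x\<in>S. h x z)"
  by (auto simp: complex_polynomial_function_def intro!: real_polynomial_function_sum)

lemma complex_polynomial_function_zpow: "complex_polynomial_function (\<lambda>z. zpow z \<alpha>)"
proof -
  have power: "complex_polynomial_function (\<lambda>z. (z $ j) ^ k)" for j k
    by (induction k) (auto intro: complex_polynomial_function_intros)
  have "complex_polynomial_function (\<lambda>z. \<Prod>j\<in>S. (z $ j) ^ (\<alpha> $ j))" if "finite S" for S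
    using that by (induction S rule: finite_induct) (auto intro: complex_polynomial_function_intros power)
  then show ?thesis by (simp add: zpow_def)
qed

lemma real_polynomial_function_reval: "real_polynomial_function (reval \<phi>)"
proof -
  have "complex_polynomial_function (ceval \<phi>)"
    unfolding ceval_def case_prod_beta
    by (intro complex_polynomial_function_sum complex_polynomial_function_intros
        complex_polynomial_function_zpow finite_keys)
  then show ?thesis by (simp add: complex_polynomial_function_def reval_def[abs_def])
qed

lemma real_polynomial_function_hsos:
  assumes "\<sigma> \<in> hsos"
  shows "real_polynomial_function \<sigma>"
proof -
  obtain d where d: "\<sigma> \<in> herm_sos d" using assms by (auto simp: hsos_def)
  obtain r p where p: "\<forall>j\<in>{1..r::nat}. p j \<in> holomorphic_polys_le d"
    and \<sigma>: "\<sigma> = (\<lambda>z. \<Sum>j=1..r. (cmod (p j z))\<^sup>2)" using d by (rule herm_sosE)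
  have "real_polynomial_function (\<lambda>z. (cmod (p j z))\<^sup>2)" if j: "j \<in> {1..r}" for j
  proof -
    obtain c where "p j = (\<lambda>z. \<Sum>\<alpha> | mdeg \<alpha> \<le> d. c \<alpha> * zpow z \<alpha>)"
      using bspec[OF p j] unfolding holomorphic_polys_le_def by blast
    then have "complex_polynomial_function (p j)"
      by (auto intro!: complex_polynomial_function_sum complex_polynomial_function_intros
          complex_polynomial_function_zpow finite_mdeg_le)
    then have "complex_polynomial_function (\<lambda>z. p j z * cnj (p j z))"
      by (intro complex_polynomial_function_intros)
    then show ?thesis
      by (simp add: complex_polynomial_function_def complex_norm_square[symmetric] flip: of_real_power)
  qed
  then show ?thesis unfolding \<sigma> by (intro real_polynomial_function_sum) auto
qed

section \<open>The Positivstellensatz on the sphere\<close>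

text \<open>Constraints enter as functions, which form a commutative ring pointwise. The convention
  \<open>G_zero\<close> mirrors \<open>with_one\<close> and puts Hermitian sums of squares
  themselves into the module.\<close>

locale sphere_module =
  fixes G :: "nat \<Rightarrow> complex ^ 'n::finite \<Rightarrow> real" and m :: nat and R :: real
  assumes G_poly: "i \<in> {0..m} \<Longrightarrow> real_polynomial_function (G i)"
    and G_zero: "G 0 = 1"
    and sphere_pos: "\<exists>i\<in>{0..m}. G i = (\<lambda>z. R\<^sup>2 - (\<Sum>j\<in>UNIV. (cmod (z $ j))\<^sup>2))"
    and sphere_neg: "\<exists>i\<in>{0..m}. G i = - (\<lambda>z. R\<^sup>2 - (\<Sum>j\<in>UNIV. (cmod (z $ j))\<^sup>2))"
begin

definition sphere :: "complex ^ 'n \<Rightarrow> real" where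
  "sphere = (\<lambda>z. R\<^sup>2 - (\<Sum>j\<in>UNIV. (cmod (z $ j))\<^sup>2))"

definition A :: "(complex ^ 'n \<Rightarrow> real) set" where
  "A = Collect real_polynomial_function"

text \<open>Hermitian sums of squares alone are not archimedean: they are nonnegative on the whole
  space, so no constant minus \<open>|z_j|^2\<close> is among them. The ideal generated by
  \<open>sphere\<close> supplies such bounds.\<close>

definition T :: "(complex ^ 'n \<Rightarrow> real) set" where
  "T = {\<sigma> + sphere * a |\<sigma> a. \<sigma> \<in> hsos \<and> a \<in> A}"

definition M :: "(complex ^ 'n \<Rightarrow> real) set" where
  "M = {\<Sum>i=0..m. \<sigma> i * G i |\<sigma>. \<forall>i\<in>{0..m}. \<sigma> i \<in> hsos}"

lemma in_A:
  "a \<in> A \<Longrightarrow> b \<in> A \<Longrightarrow> a + b \<in> A"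
  "a \<in> A \<Longrightarrow> b \<in> A \<Longrightarrow> a * b \<in> A"
  "(\<lambda>_. c) \<in> A" "\<sigma> \<in> hsos \<Longrightarrow> \<sigma> \<in> A"
  by (auto simp: A_def plus_fun_def times_fun_def real_polynomial_function_hsos)

lemma sphere_in_A: "sphere \<in> A"
  using sphere_pos G_poly unfolding A_def sphere_def by (metis mem_Collect_eq)

lemma T_intros:
  "\<sigma> \<in> hsos \<Longrightarrow> \<sigma> \<in> T"
  "a \<in> A \<Longrightarrow> sphere * a \<in> T"
  "s \<in> T \<Longrightarrow> t \<in> T \<Longrightarrow> s + t \<in> T"
  "s \<in> T \<Longrightarrow> t \<in> T \<Longrightarrow> s * t \<in> T"
proof -
  show "\<sigma> \<in> T" if "\<sigma> \<in> hsos" for \<sigma>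
  proof -
    have "\<sigma> = \<sigma> + sphere * 0" by simp
    moreover have "0 \<in> A" using in_A(3)[of 0] by (simp add: zero_fun_def)
    ultimately show ?thesis unfolding T_def using that by blast
  qed
  show "sphere * a \<in> T" if "a \<in> A" for a
  proof -
    have "sphere * a = 0 + sphere * a" by simp
    then show ?thesis unfolding T_def using that hsos_zero by blast
  qed
  show "s + t \<in> T" if st: "s \<in> T" "t \<in> T" for s t
  proof -
    obtain \<sigma> a \<tau> b where *: "s = \<sigma> + sphere * a" "t = \<tau> + sphere * b" "\<sigma> \<in> hsos" "\<tau> \<in> hsos" "a \<in> A" "b \<in> A"
      using st unfolding T_def by blast
    have "s + t = (\<sigma> + \<tau>) + sphere * (a + b)" by (simp add: * algebra_simps)
    then show ?thesis unfolding T_def using * hsos_add in_A(1) by blast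
  qed
  show "s * t \<in> T" if st: "s \<in> T" "t \<in> T" for s t
  proof -
    obtain \<sigma> a \<tau> b where *: "s = \<sigma> + sphere * a" "t = \<tau> + sphere * b" "\<sigma> \<in> hsos" "\<tau> \<in> hsos" "a \<in> A" "b \<in> A"
      using st unfolding T_def by blast
    have "s * t = \<sigma> * \<tau> + sphere * (\<sigma> * b + \<tau> * a + sphere * (a * b))"
      by (simp add: * algebra_simps)
    moreover have "\<sigma> * b + \<tau> * a + sphere * (a * b) \<in> A"
      using * sphere_in_A by (intro in_A(1,2)) (auto intro: in_A(4))
    ultimately show ?thesis unfolding T_def using * hsos_mult by blast
  qed
qed

text \<open>The square contributes exactly the \<open>|z_j|^2\<close> that the sum over the other
  coordinates omits, so \<open>sphere\<close> cancels all squared moduli. The values 1, -1,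
  \<open>\<i>\<close> and \<open>- \<i>\<close> of \<open>t\<close> bound both signs of every real
  coordinate.\<close>

lemma half_coord_in_T:
  assumes "cmod t = 1"
  shows "(\<lambda>z. (1 / 4 + R\<^sup>2) + Re (t * z $ j)) \<in> T"
proof -
  have "(\<lambda>z. (1 / 4 + R\<^sup>2) + Re (t * z $ j))
      = (\<lambda>z. (cmod (1 / 2 + t * z $ j))\<^sup>2) + (\<lambda>z. \<Sum>k\<in>UNIV - {j}. (cmod (z $ k))\<^sup>2) + sphere * 1"
    unfolding cmod_half_plus
    by (auto simp: fun_eq_iff sphere_def sum_diff1 norm_mult assms)
  moreover have "(1 :: complex ^ 'n \<Rightarrow> real) \<in> A" using in_A(3)[of 1] by (simp add: one_fun_def)
  ultimately show ?thesis
    by (simp only:) (intro T_intros hsos_affine hsos_sum_coords)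
qed

text \<open>Bounds for both signs are proved together, because the product case combines the upper
  and lower bounds of both factors.\<close>

lemma T_archimedean:
  assumes "a \<in> A"
  shows "\<exists>N. N \<ge> 0 \<and> (\<lambda>_. N) - a \<in> T \<and> (\<lambda>_. N) + a \<in> T"
proof -
  have "real_polynomial_function a" using assms by (simp add: A_def)
  then show ?thesis
  proof (induction rule: real_polynomial_function_coord_induct)
    case (const c)
    have "(\<lambda>_::complex ^ 'n. \<bar>c\<bar> - c) \<in> T" "(\<lambda>_::complex ^ 'n. \<bar>c\<bar> + c) \<in> T"
      by (intro T_intros(1) hsos_const; simp)+
    then show ?case by (intro exI[of _ "\<bar>c\<bar>"]) (auto simp: plus_fun_def fun_diff_def)
  next
    case (Re j)
    show ?case using half_coord_in_T[of 1 j] half_coord_in_T[of "- 1" j]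
      by (intro exI[of _ "1 / 4 + R\<^sup>2"]) (auto simp: plus_fun_def fun_diff_def)
  next
    case (Im j)
    show ?case using half_coord_in_T[of \<i> j] half_coord_in_T[of "- \<i>" j]
      by (intro exI[of _ "1 / 4 + R\<^sup>2"]) (auto simp: plus_fun_def fun_diff_def)
  next
    case (add f g)
    then obtain N N' where N: "N \<ge> 0" "(\<lambda>_. N) - f \<in> T" "(\<lambda>_. N) + f \<in> T"
      and N': "N' \<ge> 0" "(\<lambda>_. N') - g \<in> T" "(\<lambda>_. N') + g \<in> T" by blast
    have "(\<lambda>_. N + N') - (f + g) = ((\<lambda>_. N) - f) + ((\<lambda>_. N') - g)"
      "(\<lambda>_. N + N') + (f + g) = ((\<lambda>_. N) + f) + ((\<lambda>_. N') + g)" by auto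
    then have "(\<lambda>_. N + N') - (f + g) \<in> T" "(\<lambda>_. N + N') + (f + g) \<in> T"
      using N N' T_intros(3) by metis+
    then show ?case using N(1) N'(1) by (intro exI[of _ "N + N'"] conjI add_nonneg_nonneg)
  next
    case (mult f g)
    then obtain N N' where N: "N \<ge> 0" "(\<lambda>_. N) - f \<in> T" "(\<lambda>_. N) + f \<in> T"
      and N': "N' \<ge> 0" "(\<lambda>_. N') - g \<in> T" "(\<lambda>_. N') + g \<in> T" by blast
    have half: "(\<lambda>_. 1 / 2) \<in> T" by (intro T_intros(1) hsos_const) simp
    \<comment> \<open>The terms \<open>N * g\<close> and \<open>N' * f\<close> cancel between the
      two products, and the factor 1/2 undoes the doubling of the rest.\<close>
    have "(\<lambda>_. N * N') - f * g = (\<lambda>_. 1 / 2) *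
        (((\<lambda>_. N) + f) * ((\<lambda>_. N') - g) + ((\<lambda>_. N) - f) * ((\<lambda>_. N') + g))"
      "(\<lambda>_. N * N') + f * g = (\<lambda>_. 1 / 2) *
        (((\<lambda>_. N) + f) * ((\<lambda>_. N') + g) + ((\<lambda>_. N) - f) * ((\<lambda>_. N') - g))"
      by (auto simp: fun_eq_iff algebra_simps)
    moreover have "(\<lambda>_. 1 / 2) * (((\<lambda>_. N) + f) * ((\<lambda>_. N') - g) + ((\<lambda>_. N) - f) * ((\<lambda>_. N') + g)) \<in> T"
      "(\<lambda>_. 1 / 2) * (((\<lambda>_. N) + f) * ((\<lambda>_. N') + g) + ((\<lambda>_. N) - f) * ((\<lambda>_. N') - g)) \<in> T"
      by (intro T_intros(3,4) half N N')+
    ultimately have "(\<lambda>_. N * N') - f * g \<in> T" "(\<lambda>_. N * N') + f * g \<in> T" by metis+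
    then show ?case using N(1) N'(1) by (intro exI[of _ "N * N'"] conjI mult_nonneg_nonneg)
  qed
qed

sublocale archimedean_semiring A T "\<lambda>c _. c"
proof
  show "T \<subseteq> A" using in_A sphere_in_A by (auto simp: T_def)
  show "\<exists>N. (\<lambda>_. N) - a \<in> T" if "a \<in> A" for a using T_archimedean[OF that] by blast
  show "(\<lambda>_. r) \<in> T" if "r \<ge> 0" for r using that by (intro T_intros(1) hsos_const)
qed (fact in_A T_intros | simp add: fun_eq_iff)+

section \<open>The module generated by the constraints\<close>

lemma M_add:
  assumes "a \<in> M" "b \<in> M"
  shows "a + b \<in> M"
proof -
  obtain \<sigma> \<tau> where *: "\<forall>i\<in>{0..m}. \<sigma> i \<in> hsos" "\<forall>i\<in>{0..m}. \<tau> i \<in> hsos"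
    "a = (\<Sum>i=0..m. \<sigma> i * G i)" "b = (\<Sum>i=0..m. \<tau> i * G i)"
    using assms unfolding M_def by blast
  have "a + b = (\<Sum>i=0..m. (\<sigma> i + \<tau> i) * G i)"
    by (simp add: * sum.distrib distrib_right)
  moreover have "\<forall>i\<in>{0..m}. \<sigma> i + \<tau> i \<in> hsos" using * hsos_add by blast
  ultimately show ?thesis unfolding M_def by (intro CollectI exI[of _ "\<lambda>i. \<sigma> i + \<tau> i"] conjI)
qed

lemma M_generator:
  assumes "\<sigma> \<in> hsos" "i \<in> {0..m}"
  shows "\<sigma> * G i \<in> M"
proof -
  have "\<sigma> * G i = (\<Sum>k=0..m. (if k = i then \<sigma> else 0) * G k)"
    using assms(2) by (simp add: if_distrib[of "\<lambda>x. x * _"] sum.delta cong: if_cong)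
  moreover have "\<forall>k\<in>{0..m}. (if k = i then \<sigma> else 0) \<in> hsos" using assms(1) hsos_zero by auto
  ultimately show ?thesis unfolding M_def
    by (intro CollectI exI[of _ "\<lambda>k. if k = i then \<sigma> else 0"] conjI)
qed

text \<open>With \<open>a = \<sigma> - \<tau>\<close>, the weight \<sigma> goes to the constraint
  \<open>sphere\<close> and \<tau> to its opposite. This is where both inequalities of the sphere
  constraint act together.\<close>

lemma sphere_mult_in_M:
  assumes "a \<in> A"
  shows "sphere * a \<in> M"
proof -
  obtain \<sigma> \<tau> where *: "\<sigma> \<in> hsos" "\<tau> \<in> hsos" "a = \<sigma> - \<tau>"
    using real_polynomial_function_diff_hsos[of a] assms unfolding A_def by blast
  obtain i j where ij: "i \<in> {0..m}" "G i = sphere" "j \<in> {0..m}" "G j = - sphere"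
    using sphere_pos sphere_neg unfolding sphere_def by blast
  have "sphere * a = \<sigma> * G i + \<tau> * G j" by (simp add: * ij algebra_simps)
  then show ?thesis using M_add M_generator * ij by metis
qed

lemma M_subset: "M \<subseteq> A"
proof
  fix a assume "a \<in> M"
  then obtain \<sigma> where \<sigma>: "\<forall>i\<in>{0..m}. \<sigma> i \<in> hsos" "a = (\<Sum>i=0..m. \<sigma> i * G i)"
    unfolding M_def by blast
  have "(\<Sum>i\<in>S. \<sigma> i * G i) \<in> A" if "finite S" "S \<subseteq> {0..m}" for S
    using that
  proof (induction S rule: finite_induct)
    case empty
    then show ?case using in_A(3)[of 0] by (simp add: zero_fun_def)
  next
    case (insert i S)
    then have "\<sigma> i \<in> A" "G i \<in> A" using \<sigma> in_A(4) G_poly by (auto simp: A_def)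
    then have "\<sigma> i * G i + (\<Sum>i\<in>S. \<sigma> i * G i) \<in> A"
      by (intro in_A(1,2)) (use insert in blast)+
    then show ?case by (simp only: sum.insert[OF insert.hyps])
  qed
  then show "a \<in> A" using \<sigma>(2) by blast
qed

text \<open>For \<open>t = \<tau> + sphere * b\<close>, the factor \<tau> multiplies every weight,
  while \<open>sphere * b\<close> sends \<open>a\<close> into the ideal of \<open>sphere\<close>,
  which \<open>M\<close> contains.\<close>

lemma module_M: "module M"
  unfolding module_def
proof (intro conjI ballI)
  show "M \<subseteq> A" by (rule M_subset)
  show "1 \<in> M" using M_generator[of 1 0] hsos_const[of 1] by (simp add: G_zero one_fun_def times_fun_def)
  show "a + b \<in> M" if "a \<in> M" "b \<in> M" for a b using that by (rule M_add)
  fix t a assume "t \<in> T" and a: "a \<in> M"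
  then obtain \<tau> b where t: "t = \<tau> + sphere * b" "\<tau> \<in> hsos" "b \<in> A" unfolding T_def by blast
  obtain \<sigma> where \<sigma>: "\<forall>i\<in>{0..m}. \<sigma> i \<in> hsos" "a = (\<Sum>i=0..m. \<sigma> i * G i)"
    using a unfolding M_def by blast
  have "\<tau> * a = (\<Sum>i=0..m. (\<tau> * \<sigma> i) * G i)" by (simp add: \<sigma>(2) sum_distrib_left mult.assoc)
  moreover have "\<forall>i\<in>{0..m}. \<tau> * \<sigma> i \<in> hsos" using \<sigma>(1) t(2) hsos_mult by blast
  ultimately have "\<tau> * a \<in> M" unfolding M_def
    by (intro CollectI exI[of _ "\<lambda>i. \<tau> * \<sigma> i"] conjI)
  moreover have "sphere * (b * a) \<in> M"
    using M_subset a t(3) by (intro sphere_mult_in_M in_A(2)) auto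
  moreover have "t * a = \<tau> * a + sphere * (b * a)" by (simp add: t(1) algebra_simps)
  ultimately show "t * a \<in> M" using M_add by simp
qed

text \<open>An empty feasible set is covered too: failure of membership would itself produce a
  feasible point.\<close>

theorem positivstellensatz:
  assumes F: "real_polynomial_function F"
    and pos: "\<And>z. \<forall>i\<in>{0..m}. G i z \<ge> 0 \<Longrightarrow> F z > 0"
  shows "F \<in> M"
proof (rule ccontr)
  assume "F \<notin> M"
  moreover have "F \<in> A" using F by (simp add: A_def)
  ultimately obtain h where h: "\<And>a b. a \<in> A \<Longrightarrow> b \<in> A \<Longrightarrow> h (a + b) = h a + h b"
    "\<And>a b. a \<in> A \<Longrightarrow> b \<in> A \<Longrightarrow> h (a * b) = h a * h b"
    "\<And>r. h (\<lambda>_. r) = r" "\<And>a. a \<in> M \<Longrightarrow> h a \<ge> (0 :: real)" "h F \<le> 0"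
    using representation[OF module_M, of F] by blast
  define w :: "complex ^ 'n" where
    "w = (\<chi> j. Complex (h (\<lambda>z. Re (z $ j))) (h (\<lambda>z. Im (z $ j))))"
  \<comment> \<open>A homomorphism that fixes the constants is determined by its values at the
    coordinate functions, and these are the coordinates of \<open>w\<close>.\<close>
  have eval: "h p = p w" if "real_polynomial_function p" for p
    using that
  proof (induction rule: real_polynomial_function_coord_induct)
    case (add f g)
    then have "h (f + g) = h f + h g" by (intro h(1)) (simp_all add: A_def)
    with add show ?case by (simp add: plus_fun_def)
  next
    case (mult f g)
    then have "h (f * g) = h f * h g" by (intro h(2)) (simp_all add: A_def)
    with mult show ?case by (simp add: times_fun_def)
  qed (simp_all add: h(3) w_def)
  have "G i w \<ge> 0" if "i \<in> {0..m}" for i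
  proof -
    have "1 * G i \<in> M" using that hsos_const[of 1] by (intro M_generator) (simp_all add: one_fun_def)
    then show ?thesis using h(4)[of "G i"] eval[OF G_poly[OF that]] by simp
  qed
  then have "F w > 0" by (intro pos) blast
  then show False using h(5) eval[OF F] by simp
qed

end

section \<open>Bounds on the relaxations\<close>

text \<open>The Riesz functional, seen as a relation on functions instead of coefficient families.
  By \<open>cpoly_eqI\<close> the value \<open>v\<close> is unique, so identities between functions
  replace computations with coefficients.\<close>

definition moment_rep ::
  "(nat ^ 'n::finite \<Rightarrow> nat ^ 'n \<Rightarrow> complex) \<Rightarrow> (complex ^ 'n \<Rightarrow> complex) \<Rightarrow> complex \<Rightarrow> bool" where
  "moment_rep y h v \<longleftrightarrow> (\<exists>\<phi>. h = ceval \<phi> \<and> v = riesz y \<phi>)"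

lemma moment_rep_unique: "moment_rep y h v \<Longrightarrow> moment_rep y h w \<Longrightarrow> v = w"
  unfolding moment_rep_def using cpoly_eqI by metis

lemma moment_rep_ceval: "moment_rep y (ceval \<phi>) (riesz y \<phi>)"
  unfolding moment_rep_def by blast

lemma riesz_superset:
  assumes "finite S" "Poly_Mapping.keys \<phi> \<subseteq> S"
  shows "riesz y \<phi> = (\<Sum>p\<in>S. Poly_Mapping.lookup \<phi> p * y (fst p) (snd p))"
  unfolding riesz_def case_prod_beta prod.collapse
  by (rule sum.mono_neutral_left) (use assms in \<open>auto simp: in_keys_iff\<close>)

text \<open>Summation over the union of both supports takes care of coefficients that cancel in
  \<open>\<phi> + \<psi>\<close>.\<close>

lemma moment_rep_add:
  assumes "moment_rep y h v" "moment_rep y k w"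
  shows "moment_rep y (\<lambda>z. h z + k z) (v + w)"
proof -
  obtain \<phi> \<psi> where *: "h = ceval \<phi>" "v = riesz y \<phi>" "k = ceval \<psi>" "w = riesz y \<psi>"
    using assms unfolding moment_rep_def by blast
  let ?S = "Poly_Mapping.keys \<phi> \<union> Poly_Mapping.keys \<psi>"
  have S: "finite ?S" "Poly_Mapping.keys \<phi> \<subseteq> ?S" "Poly_Mapping.keys \<psi> \<subseteq> ?S"
    "Poly_Mapping.keys (\<phi> + \<psi>) \<subseteq> ?S"
    using Poly_Mapping.keys_add[of \<phi> \<psi>] by auto
  have "ceval (\<phi> + \<psi>) = (\<lambda>z. h z + k z)" "riesz y (\<phi> + \<psi>) = v + w"
    by (simp_all add: * fun_eq_iff ceval_superset[OF S(1)] riesz_superset[OF S(1)] S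
        lookup_add distrib_right sum.distrib)
  then show ?thesis unfolding moment_rep_def by metis
qed

lemma moment_rep_monomial: "moment_rep y (\<lambda>z. c * mono_fun p z) (c * y (fst p) (snd p))"
proof -
  have S: "finite {p}" "Poly_Mapping.keys (Poly_Mapping.single p c) \<subseteq> {p}" by auto
  have "ceval (Poly_Mapping.single p c) = (\<lambda>z. c * mono_fun p z)"
    "riesz y (Poly_Mapping.single p c) = c * y (fst p) (snd p)"
    by (simp_all add: fun_eq_iff ceval_superset[OF S] riesz_superset[OF S])
  then show ?thesis unfolding moment_rep_def by metis
qed

lemma moment_rep_sum:
  assumes "finite S" "\<And>x. x \<in> S \<Longrightarrow> moment_rep y (h x) (v x)"
  shows "moment_rep y (\<lambda>z. \<Sum>x\<in>S. h x z) (\<Sum>x\<in>S. v x)"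
  using assms
proof (induction S rule: finite_induct)
  case empty
  then show ?case using moment_rep_monomial[of y 0 0] by simp
next
  case (insert x S)
  then show ?case by (simp add: moment_rep_add)
qed

text \<open>Entries of a localizing matrix are thereby values of the Riesz functional, which lets
  matrix positivity be read as positivity of the functional.\<close>

lemma moment_rep_shift:
  "moment_rep y (\<lambda>z. c * mono_fun (\<alpha>, \<beta>) z * ceval \<phi> z) (c * loc_matrix \<phi> y \<alpha> \<beta>)"
proof -
  let ?l = "Poly_Mapping.lookup \<phi>"
  have "moment_rep y (\<lambda>z. \<Sum>p\<in>Poly_Mapping.keys \<phi>. c * ?l p * mono_fun (\<alpha> + fst p, \<beta> + snd p) z)
      (\<Sum>p\<in>Poly_Mapping.keys \<phi>. c * ?l p * y (\<alpha> + fst p) (\<beta> + snd p))"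
    using moment_rep_monomial[where p = "(_, _)"] by (intro moment_rep_sum) auto
  moreover have "c * loc_matrix \<phi> y \<alpha> \<beta> = (\<Sum>p\<in>Poly_Mapping.keys \<phi>. c * ?l p * y (\<alpha> + fst p) (\<beta> + snd p))"
    by (simp add: loc_matrix_def case_prod_beta sum_distrib_left mult.assoc)
  moreover have "c * mono_fun (\<alpha>, \<beta>) z * ceval \<phi> z
      = (\<Sum>p\<in>Poly_Mapping.keys \<phi>. c * ?l p * mono_fun (\<alpha> + fst p, \<beta> + snd p) z)" for z
    by (simp add: ceval_superset[of "Poly_Mapping.keys \<phi>"] mono_fun_def zpow_add sum_distrib_left mult_ac)
  ultimately show ?thesis by simp
qed

text \<open>If \<open>p\<close> has coefficient vector \<open>c\<close>, the functional at
  \<open>|p|^2\<close> times \<phi> is the quadratic form of the localizing matrix at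
  \<open>c\<close>.\<close>

lemma moment_rep_herm_sos_mult:
  assumes \<sigma>: "\<sigma> \<in> herm_sos e" and psd: "psd_on {\<alpha>. mdeg \<alpha> \<le> e} (loc_matrix \<phi> y)"
  shows "\<exists>v. moment_rep y (\<lambda>z. of_real (\<sigma> z) * ceval \<phi> z) v \<and> 0 \<le> Re v"
proof -
  let ?I = "{\<alpha>. mdeg \<alpha> \<le> e}"
  obtain r p where p: "\<forall>j\<in>{1..r::nat}. p j \<in> holomorphic_polys_le e"
    and \<sigma>: "\<sigma> = (\<lambda>z. \<Sum>j=1..r. (cmod (p j z))\<^sup>2)" using \<sigma> by (rule herm_sosE)
  from p have "\<forall>j\<in>{1..r}. \<exists>c. p j = (\<lambda>z. \<Sum>\<alpha>\<in>?I. c \<alpha> * zpow z \<alpha>)"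
    unfolding holomorphic_polys_le_def by blast
  then obtain c where c: "\<And>j. j \<in> {1..r} \<Longrightarrow> p j = (\<lambda>z. \<Sum>\<alpha>\<in>?I. c j \<alpha> * zpow z \<alpha>)" by metis
  let ?v = "\<Sum>j=1..r. \<Sum>\<alpha>\<in>?I. \<Sum>\<beta>\<in>?I. (cnj (c j \<alpha>) * c j \<beta>) * loc_matrix \<phi> y \<alpha> \<beta>"
  have "moment_rep y (\<lambda>z. \<Sum>j=1..r. \<Sum>\<alpha>\<in>?I. \<Sum>\<beta>\<in>?I. (cnj (c j \<alpha>) * c j \<beta>) * mono_fun (\<alpha>, \<beta>) z * ceval \<phi> z) ?v"
    by (intro moment_rep_sum moment_rep_shift finite_mdeg_le) simp
  moreover have "of_real (\<sigma> z) * ceval \<phi> z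
      = (\<Sum>j=1..r. \<Sum>\<alpha>\<in>?I. \<Sum>\<beta>\<in>?I. (cnj (c j \<alpha>) * c j \<beta>) * mono_fun (\<alpha>, \<beta>) z * ceval \<phi> z)" for z
  proof -
    have "of_real ((cmod (p j z))\<^sup>2) = (\<Sum>\<alpha>\<in>?I. \<Sum>\<beta>\<in>?I. (cnj (c j \<alpha>) * c j \<beta>) * mono_fun (\<alpha>, \<beta>) z)"
      if "j \<in> {1..r}" for j
    proof -
      have "of_real ((cmod (p j z))\<^sup>2) = cnj (p j z) * p j z"
        unfolding complex_norm_square by (rule mult.commute)
      also have "\<dots> = (\<Sum>\<alpha>\<in>?I. \<Sum>\<beta>\<in>?I. (cnj (c j \<alpha>) * c j \<beta>) * mono_fun (\<alpha>, \<beta>) z)"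
        unfolding c[OF that] cnj_sum sum_product by (simp add: mono_fun_def mult_ac)
      finally show ?thesis .
    qed
    then show ?thesis by (simp add: \<sigma> sum_distrib_right)
  qed
  moreover have "0 \<le> Re ?v"
  proof -
    have "0 \<le> Re (\<Sum>\<alpha>\<in>?I. \<Sum>\<beta>\<in>?I. cnj (c j \<alpha>) * loc_matrix \<phi> y \<alpha> \<beta> * c j \<beta>)" for j
      using psd unfolding psd_on_def by blast
    then show ?thesis unfolding Re_sum[of _ "{1..r}"] by (intro sum_nonneg) (simp add: mult_ac)
  qed
  ultimately show ?thesis by (intro exI[of _ ?v]) simp
qed

section \<open>Weak duality and the upper bound by point evaluations\<close>

lemma ceval_real: "\<phi> \<in> real_polys \<Longrightarrow> ceval \<phi> z = of_real (reval \<phi> z)"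
  unfolding real_polys_def real_polys_le_def reval_def by (auto simp: of_real_Re)

lemma ceval_one: "ceval 1 z = 1"
proof -
  have "ceval 1 z = (\<Sum>p\<in>{0}. Poly_Mapping.lookup 1 p * mono_fun p z)"
    by (rule ceval_superset) auto
  then show ?thesis by (simp add: mono_fun_def)
qed

lemma reval_one: "reval 1 z = 1"
  by (simp add: reval_def ceval_one)

lemma one_real_poly: "1 \<in> real_polys_le 0"
  by (auto simp: real_polys_le_def ceval_one zero_prod_def)

lemma with_one_real_polys:
  assumes "\<forall>i\<in>{1..m}. g i \<in> real_polys" "i \<in> {0..m}"
  shows "with_one g i \<in> real_polys"
  using assms one_real_poly by (auto simp: with_one_def real_polys_def)

lemma cdegree_with_one_le:
  assumes "i \<in> {0..m}"
  shows "cdegree (with_one g i) \<le> d_min f g m"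
proof (cases "i = 0")
  case True
  have "cdegree (1 :: 'a cpoly) \<le> 0" unfolding cdegree_def using one_real_poly by (rule Least_le)
  then show ?thesis by (simp add: with_one_def True)
next
  case False
  then have "with_one g i = g i" "i \<in> {1..m}" using assms by (auto simp: with_one_def)
  then show ?thesis unfolding d_min_def by (intro Max_ge) auto
qed

lemma cdegree_le_d_min: "cdegree f \<le> d_min f g m"
  unfolding d_min_def by (rule Max_ge) auto

text \<open>The Riesz functional is applied to the certificate: \<open>y 0 0 = 1\<close> preserves
  the constant \<open>l\<close>, and each weighted constraint contributes a nonnegative
  amount.\<close>

lemma sos_value_le_moment_value:
  assumes f: "f \<in> real_polys" and g: "\<forall>i\<in>{1..m}. g i \<in> real_polys"
  shows "sos_value f g m d \<le> moment_value f g m d"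
  unfolding sos_value_def moment_value_def
proof (intro Sup_least Inf_greatest, clarify)
  fix l y \<sigma>
  assume \<sigma>: "\<forall>i\<in>{0..m}. \<sigma> i \<in> herm_sos (d - cdegree (with_one g i))"
    and eq: "\<forall>z. reval f z - l = (\<Sum>i=0..m. \<sigma> i z * reval (with_one g i) z)"
    and y: "y 0 0 = 1"
    and psd: "\<forall>i\<in>{0..m}. psd_on {\<alpha>. mdeg \<alpha> \<le> d - cdegree (with_one g i)} (loc_matrix (with_one g i) y)"
  have "\<forall>i\<in>{0..m}. \<exists>v. moment_rep y (\<lambda>z. of_real (\<sigma> i z) * ceval (with_one g i) z) v \<and> 0 \<le> Re v"
    using \<sigma> psd moment_rep_herm_sos_mult by blast
  then obtain v where v: "\<And>i. i \<in> {0..m} \<Longrightarrow> moment_rep y (\<lambda>z. of_real (\<sigma> i z) * ceval (with_one g i) z) (v i)"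
    "\<And>i. i \<in> {0..m} \<Longrightarrow> 0 \<le> Re (v i)" by metis
  have "moment_rep y (\<lambda>z. of_real l * mono_fun (0, 0) z
      + (\<Sum>i=0..m. of_real (\<sigma> i z) * ceval (with_one g i) z)) (of_real l * y 0 0 + (\<Sum>i=0..m. v i))"
    using moment_rep_monomial[of y "of_real l" "(0, 0)"] v(1)
    by (intro moment_rep_add moment_rep_sum) simp_all
  also have "(\<lambda>z. of_real l * mono_fun (0, 0) z
      + (\<Sum>i=0..m. of_real (\<sigma> i z) * ceval (with_one g i) z)) = ceval f"
  proof
    fix z
    have "ceval f z = of_real (l + (\<Sum>i=0..m. \<sigma> i z * reval (with_one g i) z))"
      using eq[rule_format, of z] by (simp add: ceval_real[OF f] algebra_simps del: of_real_add of_real_sum)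
    also have "\<dots> = of_real l + (\<Sum>i=0..m. of_real (\<sigma> i z) * ceval (with_one g i) z)"
      by (simp add: ceval_real[OF with_one_real_polys[OF g]])
    finally show "of_real l * mono_fun (0, 0) z
      + (\<Sum>i=0..m. of_real (\<sigma> i z) * ceval (with_one g i) z) = ceval f z" by (simp add: mono_fun_def)
  qed
  finally have "riesz y f = of_real l * y 0 0 + (\<Sum>i=0..m. v i)"
    using moment_rep_unique moment_rep_ceval by blast
  then have "Re (riesz y f) = l + (\<Sum>i=0..m. Re (v i))" by (simp add: y)
  moreover have "(\<Sum>i=0..m. Re (v i)) \<ge> 0" using v(2) by (rule sum_nonneg)
  ultimately show "ereal l \<le> ereal (Re (riesz y f))" by simp
qed

text \<open>The truncated moments of the Dirac measure at a feasible \<open>z\<close> form an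
  admissible family whose objective value is \<open>reval f z\<close>.\<close>

lemma moment_value_le_f_opt:
  fixes f :: "'n::finite cpoly" and g :: "nat \<Rightarrow> 'n cpoly"
  assumes f: "f \<in> real_polys" and g: "\<forall>i\<in>{1..m}. g i \<in> real_polys" and d: "d_min f g m \<le> d"
  shows "moment_value f g m d \<le> f_opt f g m"
  unfolding f_opt_def
proof (rule INF_greatest)
  fix z assume z: "z \<in> feasible_set g m"
  define y where "y = (\<lambda>\<alpha> \<beta>. if mdeg \<alpha> \<le> d \<and> mdeg \<beta> \<le> d then mono_fun (\<alpha>, \<beta>) z else 0)"
  have deg: "mdeg \<alpha> \<le> cdegree \<phi>" "mdeg \<beta> \<le> cdegree \<phi>"
    if "\<phi> \<in> real_polys" "(\<alpha>, \<beta>) \<in> Poly_Mapping.keys \<phi>" for \<phi> :: "'n cpoly" and \<alpha> \<beta>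
    using cdegree_mem[OF that(1)] that(2) by (auto simp: real_polys_le_def)
  have loc: "loc_matrix \<phi> y \<alpha> \<beta> = mono_fun (\<alpha>, \<beta>) z * ceval \<phi> z"
    if \<phi>: "\<phi> \<in> real_polys" "cdegree \<phi> \<le> d" and deg': "mdeg \<alpha> \<le> d - cdegree \<phi>" "mdeg \<beta> \<le> d - cdegree \<phi>"
    for \<phi> :: "'n cpoly" and \<alpha> \<beta>
  proof -
    have "loc_matrix \<phi> y \<alpha> \<beta> = (\<Sum>p\<in>Poly_Mapping.keys \<phi>. Poly_Mapping.lookup \<phi> p * mono_fun (\<alpha> + fst p, \<beta> + snd p) z)"
      unfolding loc_matrix_def
    proof (rule sum.cong, simp, clarify)
      fix \<gamma> \<delta> assume "(\<gamma>, \<delta>) \<in> Poly_Mapping.keys \<phi>"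
      \<comment> \<open>Rows and columns stop at \<open>d - cdegree \<phi>\<close>, so shifted
        indices stay within \<open>d\<close> and the default value 0 of \<open>y\<close> is never
        reached.\<close>
      from deg[OF \<phi>(1) this] have "mdeg (\<alpha> + \<gamma>) \<le> d" "mdeg (\<beta> + \<delta>) \<le> d"
        using \<phi>(2) deg' unfolding mdeg_add by linarith+
      then show "Poly_Mapping.lookup \<phi> (\<gamma>, \<delta>) * y (\<alpha> + \<gamma>) (\<beta> + \<delta>)
          = Poly_Mapping.lookup \<phi> (\<gamma>, \<delta>) * mono_fun (\<alpha> + fst (\<gamma>, \<delta>), \<beta> + snd (\<gamma>, \<delta>)) z"
        by (simp add: y_def)
    qed
    then show ?thesis
      by (simp add: ceval_superset[of "Poly_Mapping.keys \<phi>"] mono_fun_def zpow_add sum_distrib_left mult_ac)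
  qed
  have psd: "psd_on {\<alpha>. mdeg \<alpha> \<le> d - cdegree \<phi>} (loc_matrix \<phi> y)"
    if \<phi>: "\<phi> \<in> real_polys" "cdegree \<phi> \<le> d" "reval \<phi> z \<ge> 0" for \<phi> :: "'n cpoly"
    unfolding psd_on_def
  proof (intro conjI ballI allI)
    fix a b :: "nat ^ 'n" assume "a \<in> {\<alpha>. mdeg \<alpha> \<le> d - cdegree \<phi>}" "b \<in> {\<alpha>. mdeg \<alpha> \<le> d - cdegree \<phi>}"
    then show "cnj (loc_matrix \<phi> y a b) = loc_matrix \<phi> y b a"
      using \<phi> by (simp add: loc mono_fun_def ceval_real)
  next
    fix v :: "nat ^ 'n \<Rightarrow> complex"
    let ?I = "{\<alpha>. mdeg \<alpha> \<le> d - cdegree \<phi>}" and ?p = "\<Sum>\<alpha> | mdeg \<alpha> \<le> d - cdegree \<phi>. v \<alpha> * zpow z \<alpha>"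
    \<comment> \<open>The localizing matrix is \<open>reval \<phi> z\<close> times a matrix of rank
      one, so its form is \<open>reval \<phi> z\<close> times a squared modulus.\<close>
    have "(\<Sum>a\<in>?I. \<Sum>b\<in>?I. cnj (v a) * loc_matrix \<phi> y a b * v b)
        = (\<Sum>a\<in>?I. \<Sum>b\<in>?I. of_real (reval \<phi> z) * (cnj (v a * zpow z a) * (v b * zpow z b)))"
      using \<phi> by (intro sum.cong refl) (simp add: loc mono_fun_def ceval_real)
    also have "\<dots> = of_real (reval \<phi> z) * (cnj ?p * ?p)"
      unfolding cnj_sum sum_product by (simp add: sum_distrib_left)
    also have "cnj ?p * ?p = of_real ((cmod ?p)\<^sup>2)" unfolding complex_norm_square by (rule mult.commute)
    finally show "0 \<le> Re (\<Sum>a\<in>?I. \<Sum>b\<in>?I. cnj (v a) * loc_matrix \<phi> y a b * v b)"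
      using \<phi>(3) by (simp flip: of_real_mult of_real_power)
  qed
  have "y \<in> herm_families d"
    by (auto simp: herm_families_def y_def mono_fun_def)
  moreover have "y 0 0 = 1" by (simp add: y_def mono_fun_def)
  moreover have "\<forall>i\<in>{0..m}. psd_on {\<alpha>. mdeg \<alpha> \<le> d - cdegree (with_one g i)} (loc_matrix (with_one g i) y)"
  proof
    fix i assume i: "i \<in> {0..m}"
    have "reval (with_one g i) z \<ge> 0"
      using z i by (cases "i = 0") (auto simp: with_one_def reval_one feasible_set_def)
    then show "psd_on {\<alpha>. mdeg \<alpha> \<le> d - cdegree (with_one g i)} (loc_matrix (with_one g i) y)"
      using with_one_real_polys[OF g i] cdegree_with_one_le[OF i, of g f] d by (intro psd) auto
  qed
  moreover have "riesz y f = ceval f z"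
  proof -
    have "riesz y f = (\<Sum>p\<in>Poly_Mapping.keys f. Poly_Mapping.lookup f p * mono_fun p z)"
      unfolding riesz_def
    proof (rule sum.cong, simp, clarify)
      fix \<alpha> \<beta> assume "(\<alpha>, \<beta>) \<in> Poly_Mapping.keys f"
      from deg[OF f this] have "mdeg \<alpha> \<le> d" "mdeg \<beta> \<le> d"
        using cdegree_le_d_min[of f g m] d by linarith+
      then show "Poly_Mapping.lookup f (\<alpha>, \<beta>) * y \<alpha> \<beta> = Poly_Mapping.lookup f (\<alpha>, \<beta>) * mono_fun (\<alpha>, \<beta>) z"
        by (simp add: y_def)
    qed
    then show ?thesis by (simp add: ceval_superset[of "Poly_Mapping.keys f"])
  qed
  ultimately show "moment_value f g m d \<le> ereal (reval f z)"
    unfolding moment_value_def reval_def by (intro Inf_lower CollectI exI[of _ y]) simp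
qed

lemma sum_fun_apply: "(\<Sum>i\<in>S. h i) z = (\<Sum>i\<in>S. h i z)"
  by (induction S rule: infinite_finite_induct) auto

text \<open>The Positivstellensatz gives a certificate of some finite degree, which is admissible at
  every sufficiently large order.\<close>

lemma sos_value_ge:
  fixes f :: "'n::finite cpoly" and g :: "nat \<Rightarrow> 'n cpoly"
  assumes pos: "\<exists>i\<in>{1..m}. \<forall>z. reval (g i) z = R\<^sup>2 - (\<Sum>j\<in>UNIV. (cmod (z $ j))\<^sup>2)"
    and neg: "\<exists>i\<in>{1..m}. \<forall>z. reval (g i) z = - (R\<^sup>2 - (\<Sum>j\<in>UNIV. (cmod (z $ j))\<^sup>2))"
    and l: "\<And>z. z \<in> feasible_set g m \<Longrightarrow> l < reval f z"
  shows "\<exists>D. \<forall>d\<ge>D. ereal l \<le> sos_value f g m d"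
proof -
  interpret sphere_module "\<lambda>i. reval (with_one g i)" m R
  proof
    show "real_polynomial_function (reval (with_one g i))" for i
      by (rule real_polynomial_function_reval)
    show "reval (with_one g 0) = 1" by (simp add: with_one_def fun_eq_iff reval_one)
    show "\<exists>i\<in>{0..m}. reval (with_one g i) = (\<lambda>z. R\<^sup>2 - (\<Sum>j\<in>UNIV. (cmod (z $ j))\<^sup>2))"
    proof -
      from pos obtain i where "i \<in> {1..m}" and
        "\<forall>z. reval (g i) z = R\<^sup>2 - (\<Sum>j\<in>UNIV. (cmod (z $ j))\<^sup>2)" by blast
      then show ?thesis by (intro bexI[of _ i]) (auto simp: with_one_def fun_eq_iff)
    qed
    show "\<exists>i\<in>{0..m}. reval (with_one g i) = - (\<lambda>z. R\<^sup>2 - (\<Sum>j\<in>UNIV. (cmod (z $ j))\<^sup>2))"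
    proof -
      from neg obtain i where "i \<in> {1..m}" and
        "\<forall>z. reval (g i) z = - (R\<^sup>2 - (\<Sum>j\<in>UNIV. (cmod (z $ j))\<^sup>2))" by blast
      then show ?thesis by (intro bexI[of _ i]) (auto simp: with_one_def fun_eq_iff)
    qed
  qed
  have "(\<lambda>z. reval f z - l) \<in> M"
  proof (rule positivstellensatz)
    show "real_polynomial_function (\<lambda>z. reval f z - l)"
      by (intro real_polynomial_function_diff real_polynomial_function_reval real_polynomial_function.intros)
    show "0 < reval f z - l" if "\<forall>i\<in>{0..m}. 0 \<le> reval (with_one g i) z" for z
    proof -
      have "0 \<le> reval (g i) z" if "i \<in> {1..m}" for i
        using bspec[OF \<open>\<forall>i\<in>{0..m}. _\<close>, of i] that by (simp add: with_one_def)
      then show ?thesis using l[of z] by (simp add: feasible_set_def)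
    qed
  qed
  then obtain \<sigma> where \<sigma>: "\<forall>i\<in>{0..m}. \<sigma> i \<in> hsos"
    and eq: "(\<lambda>z. reval f z - l) = (\<Sum>i=0..m. \<sigma> i * reval (with_one g i))"
    unfolding M_def by blast
  from \<sigma> have "\<forall>i\<in>{0..m}. \<exists>e. \<sigma> i \<in> herm_sos e" by (simp add: hsos_def)
  then obtain e where e: "\<And>i. i \<in> {0..m} \<Longrightarrow> \<sigma> i \<in> herm_sos (e i)" by metis
  \<comment> \<open>The total of all degrees is a crude common bound; it ensures
    \<open>e i \<le> d - cdegree (with_one g i)\<close> for every \<open>i\<close> once
    \<open>d \<ge> D\<close>.\<close>
  define D where "D = (\<Sum>i=0..m. e i + cdegree (with_one g i))"
  have "ereal l \<le> sos_value f g m d" if "d \<ge> D" for d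
  proof -
    have "\<forall>i\<in>{0..m}. \<sigma> i \<in> herm_sos (d - cdegree (with_one g i))"
    proof
      fix i assume i: "i \<in> {0..m}"
      then have "e i + cdegree (with_one g i) \<le> D" unfolding D_def
        by (intro member_le_sum) auto
      then show "\<sigma> i \<in> herm_sos (d - cdegree (with_one g i))"
        using e[OF i] \<open>d \<ge> D\<close> by (elim herm_sos_mono) simp
    qed
    moreover have "\<forall>z. reval f z - l = (\<Sum>i=0..m. \<sigma> i z * reval (with_one g i) z)"
      using fun_cong[OF eq] by (simp add: sum_fun_apply)
    ultimately show ?thesis unfolding sos_value_def
      by (intro Sup_upper CollectI exI[of _ l] conjI refl exI[of _ \<sigma>])
  qed
  then show ?thesis by blast
qed

section \<open>Convergence\<close>

theorem corollary3p4:
  fixes f :: "'n::finite cpoly" and g :: "nat \<Rightarrow> 'n cpoly" and m :: nat and R :: real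
  assumes "m \<ge> 1"
    and "f \<in> real_polys"
    and "\<forall>i\<in>{1..m}. g i \<in> real_polys"
    and "R > 0"
    and "\<exists>i\<in>{1..m}. \<forall>z. reval (g i) z = R\<^sup>2 - (\<Sum>j\<in>UNIV. (cmod (z $ j))\<^sup>2)"
    and "\<exists>i\<in>{1..m}. \<forall>z. reval (g i) z = - (R\<^sup>2 - (\<Sum>j\<in>UNIV. (cmod (z $ j))\<^sup>2))"
  shows "(\<lambda>d. sos_value f g m (d_min f g m + d)) \<longlonglongrightarrow> f_opt f g m
       \<and> (\<lambda>d. moment_value f g m (d_min f g m + d)) \<longlonglongrightarrow> f_opt f g m"
proof -
  let ?s = "\<lambda>d. sos_value f g m (d_min f g m + d)" and ?v = "\<lambda>d. moment_value f g m (d_min f g m + d)"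
  have sv: "?s d \<le> ?v d" for d using assms(2,3) by (rule sos_value_le_moment_value)
  have vf: "?v d \<le> f_opt f g m" for d using assms(2,3) by (rule moment_value_le_f_opt) simp
  have s: "?s \<longlonglongrightarrow> f_opt f g m"
  proof (rule order_tendstoI)
    \<comment> \<open>A real \<open>l\<close> strictly between makes \<open>f - l\<close> strictly
      positive on the feasible set. If that set is empty, the optimum is infinite and
      \<open>l\<close> need only exceed \<open>a\<close>.\<close>
    fix a assume "a < f_opt f g m"
    then obtain l :: real where l: "a < ereal l" "ereal l < f_opt f g m"
      using ereal_dense2 by blast
    have "l < reval f z" if "z \<in> feasible_set g m" for z
    proof -
      have "f_opt f g m \<le> ereal (reval f z)" unfolding f_opt_def using that by (rule INF_lower)
      with l(2) show ?thesis by (metis ereal_less_eq(3) not_less order_less_le_trans)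
    qed
    from sos_value_ge[OF assms(5,6) this] obtain D where "\<forall>d\<ge>D. ereal l \<le> sos_value f g m d" by blast
    then show "\<forall>\<^sub>F d in sequentially. a < ?s d"
      using l(1) by (intro eventually_sequentiallyI[of D]) (auto intro: less_le_trans)
  next
    fix a assume "f_opt f g m < a"
    then show "\<forall>\<^sub>F d in sequentially. ?s d < a"
      by (intro always_eventually allI le_less_trans[OF order_trans[OF sv vf]])
  qed
  moreover have "?v \<longlonglongrightarrow> f_opt f g m"
    by (rule tendsto_sandwich[OF _ _ s tendsto_const]) (simp_all add: sv vf)
  ultimately show ?thesis ..
qed

end
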